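(* Let $L$ be a co-Brouwerian semilattice (CBS). Then $L$ is existentially closed (for the theory of CBSes) if and only if for every finite sub-CBS $L_0\subseteq L$ and every finite CBS $C$ which is an extension of $L_0$ (i.e. $L_0\subseteq C$ as a sub-CBS), there exists an embedding $C\to L$ fixing $L_0$ pointwise.
   Context: A co-Brouwerian semilattice (CBS) is a poset $(L,\le)$ with least element $0$ in which every pair $a,b$ has a join $a\vee b$ and a difference $a-b$ characterized by: for all $c$, $a-b\le c$ iff $a\le b\vee c$. CBSes form a variety in the signature $(0,\vee,-)$; sub-CBSes, extensions and embeddings are taken with respect to this signature. A CBS $A$ is existentially closed if for every CBS $B\supseteq A$ every existential sentence with parameters from $A$ true in $B$ is true in $A$. *)

theory Defs
  imports "HOL-Algebra.Lattice" "HOL-Library.Equipollence"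
begin

section \<open>Co-Brouwerian semilattices\<close>

locale co_brouwerian_semilattice = upper_semilattice L + weak_partial_order_bottom L
  for L (structure) +
  assumes diff_exists:
    "\<lbrakk>a \<in> carrier L; b \<in> carrier L\<rbrakk> \<Longrightarrow>
      \<exists>d\<in>carrier L. \<forall>c\<in>carrier L. d \<sqsubseteq> c \<longleftrightarrow> a \<sqsubseteq> b \<squnion> c"

definition diff :: "('a, 'm) gorder_scheme \<Rightarrow> 'a \<Rightarrow> 'a \<Rightarrow> 'a" (infixl \<open>\<setminus>\<index>\<close> 65) where
  "a \<setminus>\<^bsub>L\<^esub> b =
    (THE d. d \<in> carrier L \<and> (\<forall>c\<in>carrier L. d \<sqsubseteq>\<^bsub>L\<^esub> c \<longleftrightarrow> a \<sqsubseteq>\<^bsub>L\<^esub> b \<squnion>\<^bsub>L\<^esub> c))"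

context co_brouwerian_semilattice
begin

lemma diff_unique:
  assumes "d \<in> carrier L" "\<And>c. c \<in> carrier L \<Longrightarrow> d \<sqsubseteq> c \<longleftrightarrow> a \<sqsubseteq> b \<squnion> c"
  shows "a \<setminus> b = d"
  unfolding diff_def
proof (rule the_equality)
  show "d \<in> carrier L \<and> (\<forall>c\<in>carrier L. d \<sqsubseteq> c \<longleftrightarrow> a \<sqsubseteq> b \<squnion> c)"
    using assms by blast
next
  fix d' assume "d' \<in> carrier L \<and> (\<forall>c\<in>carrier L. d' \<sqsubseteq> c \<longleftrightarrow> a \<sqsubseteq> b \<squnion> c)"
  with assms show "d' = d" by (meson le_antisym le_refl)
qed

lemma
  assumes "a \<in> carrier L" "b \<in> carrier L"
  shows diff_closed: "a \<setminus> b \<in> carrier L"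
    and diff_le_iff: "c \<in> carrier L \<Longrightarrow> a \<setminus> b \<sqsubseteq> c \<longleftrightarrow> a \<sqsubseteq> b \<squnion> c"
proof -
  obtain d where d: "d \<in> carrier L" "\<forall>c\<in>carrier L. d \<sqsubseteq> c \<longleftrightarrow> a \<sqsubseteq> b \<squnion> c"
    using diff_exists[OF assms] by blast
  then have "a \<setminus> b = d" by (intro diff_unique) auto
  with d show "a \<setminus> b \<in> carrier L"
    and "c \<in> carrier L \<Longrightarrow> a \<setminus> b \<sqsubseteq> c \<longleftrightarrow> a \<sqsubseteq> b \<squnion> c"
    by auto
qed

end

definition sub_cbs :: "'a set \<Rightarrow> ('a, 'm) gorder_scheme \<Rightarrow> bool" where
  "sub_cbs S L \<longleftrightarrow>
    S \<subseteq> carrier L \<and> \<bottom>\<^bsub>L\<^esub> \<in> S \<and>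
    (\<forall>a\<in>S. \<forall>b\<in>S. a \<squnion>\<^bsub>L\<^esub> b \<in> S \<and> a \<setminus>\<^bsub>L\<^esub> b \<in> S)"

definition cbs_embedding ::
  "('a \<Rightarrow> 'b) \<Rightarrow> ('a, 'm) gorder_scheme \<Rightarrow> ('b, 'n) gorder_scheme \<Rightarrow> bool" where
  "cbs_embedding f A B \<longleftrightarrow>
    f \<in> carrier A \<rightarrow> carrier B \<and> inj_on f (carrier A) \<and>
    f \<bottom>\<^bsub>A\<^esub> = \<bottom>\<^bsub>B\<^esub> \<and>
    (\<forall>a\<in>carrier A. \<forall>b\<in>carrier A.
      f (a \<squnion>\<^bsub>A\<^esub> b) = f a \<squnion>\<^bsub>B\<^esub> f b \<and> f (a \<setminus>\<^bsub>A\<^esub> b) = f a \<setminus>\<^bsub>B\<^esub> f b)"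

text \<open>
  The structure \<open>L\<lparr>carrier := S\<rparr>\<close> computes its own zero, join and difference from the
  restricted order; for a sub-CBS these are the ones of \<open>L\<close>.
\<close>

lemma (in co_brouwerian_semilattice) sub_cbs_restrict:
  assumes "sub_cbs S L"
  shows "co_brouwerian_semilattice (L\<lparr>carrier := S\<rparr>)"
    and "\<bottom>\<^bsub>L\<lparr>carrier := S\<rparr>\<^esub> = \<bottom>"
    and "\<lbrakk>a \<in> S; b \<in> S\<rbrakk> \<Longrightarrow> a \<squnion>\<^bsub>L\<lparr>carrier := S\<rparr>\<^esub> b = a \<squnion> b"
    and "\<lbrakk>a \<in> S; b \<in> S\<rbrakk> \<Longrightarrow> a \<setminus>\<^bsub>L\<lparr>carrier := S\<rparr>\<^esub> b = a \<setminus> b"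
proof -
  let ?S = "L\<lparr>carrier := S\<rparr>"
  have S: "S \<subseteq> carrier L" "\<bottom> \<in> S" "\<And>a b. \<lbrakk>a \<in> S; b \<in> S\<rbrakk> \<Longrightarrow> a \<squnion> b \<in> S"
    "\<And>a b. \<lbrakk>a \<in> S; b \<in> S\<rbrakk> \<Longrightarrow> a \<setminus> b \<in> S"
    using assms by (auto simp: sub_cbs_def)
  have [intro]: "x \<in> carrier L" if "x \<in> S" for x using S that by blast
  interpret S: partial_order ?S
    by unfold_locales (auto simp: eq_is_equal intro: le_antisym le_trans)
  have lub: "least ?S (a \<squnion> b) (Upper ?S {a, b})" if "a \<in> S" "b \<in> S" for a b
    using that S by (intro least_UpperI) (auto simp: Upper_def intro: join_left join_right join_le)
  have bot: "least ?S \<bottom> (carrier ?S)"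
    using S by (auto simp: least_def)
  show bot_eq: "\<bottom>\<^bsub>?S\<^esub> = \<bottom>"
    unfolding bottom_def[of ?S] using bot by (blast intro: S.least_unique)
  have join_eq: "a \<squnion>\<^bsub>?S\<^esub> b = a \<squnion> b" if "a \<in> S" "b \<in> S" for a b
    unfolding join_def[of ?S] sup_def[of ?S]
    using lub[OF that] by (blast intro: S.least_unique)
  show "a \<squnion>\<^bsub>?S\<^esub> b = a \<squnion> b" if "a \<in> S" "b \<in> S" using join_eq that .
  interpret S: co_brouwerian_semilattice ?S
  proof unfold_locales
    show "\<exists>s. least ?S s (Upper ?S {x, y})" if "x \<in> carrier ?S" "y \<in> carrier ?S" for x y
      using lub that by auto
    show "\<exists>x. least ?S x (carrier ?S)" using bot by blast
    show "\<exists>d\<in>carrier ?S. \<forall>c\<in>carrier ?S. d \<sqsubseteq>\<^bsub>?S\<^esub> c \<longleftrightarrow> a \<sqsubseteq>\<^bsub>?S\<^esub> b \<squnion>\<^bsub>?S\<^esub> c"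
      if "a \<in> carrier ?S" "b \<in> carrier ?S" for a b
      using that S by (intro bexI[of _ "a \<setminus> b"]) (auto simp: join_eq diff_le_iff subset_iff)
  qed
  show "co_brouwerian_semilattice ?S" by (rule S.co_brouwerian_semilattice_axioms)
  show "a \<setminus>\<^bsub>?S\<^esub> b = a \<setminus> b" if "a \<in> S" "b \<in> S"
    using that S by (intro S.diff_unique) (auto simp: join_eq diff_le_iff subset_iff)
qed


section \<open>Existential sentences with parameters\<close>

text \<open>
  The set functions \<open>term_params\<close> and \<open>qf_params\<close> collect the parameters occurring
  in a term or formula.
\<close>

datatype (term_params: 'p) cbs_term =
  Var nat | Param 'p | Zero | Join "'p cbs_term" "'p cbs_term" | Diff "'p cbs_term" "'p cbs_term"

datatype (qf_params: 'p) qf_formula =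
  Eq "'p cbs_term" "'p cbs_term"
| Neg "'p qf_formula"
| Conj "'p qf_formula" "'p qf_formula"
| Disj "'p qf_formula" "'p qf_formula"

primrec term_vars :: "'p cbs_term \<Rightarrow> nat set" where
  "term_vars (Var n) = {n}"
| "term_vars (Param p) = {}"
| "term_vars Zero = {}"
| "term_vars (Join s t) = term_vars s \<union> term_vars t"
| "term_vars (Diff s t) = term_vars s \<union> term_vars t"

primrec qf_vars :: "'p qf_formula \<Rightarrow> nat set" where
  "qf_vars (Eq s t) = term_vars s \<union> term_vars t"
| "qf_vars (Neg \<phi>) = qf_vars \<phi>"
| "qf_vars (Conj \<phi> \<psi>) = qf_vars \<phi> \<union> qf_vars \<psi>"
| "qf_vars (Disj \<phi> \<psi>) = qf_vars \<phi> \<union> qf_vars \<psi>"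

primrec term_val ::
  "('b, 'm) gorder_scheme \<Rightarrow> ('p \<Rightarrow> 'b) \<Rightarrow> (nat \<Rightarrow> 'b) \<Rightarrow> 'p cbs_term \<Rightarrow> 'b" where
  "term_val B e v (Var n) = v n"
| "term_val B e v (Param p) = e p"
| "term_val B e v Zero = \<bottom>\<^bsub>B\<^esub>"
| "term_val B e v (Join s t) = term_val B e v s \<squnion>\<^bsub>B\<^esub> term_val B e v t"
| "term_val B e v (Diff s t) = term_val B e v s \<setminus>\<^bsub>B\<^esub> term_val B e v t"

primrec qf_sat ::
  "('b, 'm) gorder_scheme \<Rightarrow> ('p \<Rightarrow> 'b) \<Rightarrow> (nat \<Rightarrow> 'b) \<Rightarrow> 'p qf_formula \<Rightarrow> bool" where
  "qf_sat B e v (Eq s t) \<longleftrightarrow> term_val B e v s = term_val B e v t"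
| "qf_sat B e v (Neg \<phi>) \<longleftrightarrow> \<not> qf_sat B e v \<phi>"
| "qf_sat B e v (Conj \<phi> \<psi>) \<longleftrightarrow> qf_sat B e v \<phi> \<and> qf_sat B e v \<psi>"
| "qf_sat B e v (Disj \<phi> \<psi>) \<longleftrightarrow> qf_sat B e v \<phi> \<or> qf_sat B e v \<psi>"

text \<open>
  \<open>Exists n \<phi>\<close> is the formula \<open>\<exists>x\<^sub>0 \<dots> x\<^sub>n\<^sub>-\<^sub>1. \<phi>\<close>, where \<open>x\<^sub>i\<close> is \<open>Var i\<close>; it is a sentence
  with parameters in \<open>P\<close> if no variable is free and all its parameters belong to \<open>P\<close>.
\<close>

datatype 'p ex_formula = Exists nat "'p qf_formula"

primrec existential_sentence :: "'p set \<Rightarrow> 'p ex_formula \<Rightarrow> bool" where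
  "existential_sentence P (Exists n \<phi>) \<longleftrightarrow> qf_vars \<phi> \<subseteq> {..<n} \<and> qf_params \<phi> \<subseteq> P"

primrec true_in :: "('b, 'm) gorder_scheme \<Rightarrow> ('p \<Rightarrow> 'b) \<Rightarrow> 'p ex_formula \<Rightarrow> bool" where
  "true_in B e (Exists n \<phi>) \<longleftrightarrow> (\<exists>v. (\<forall>i<n. v i \<in> carrier B) \<and> qf_sat B e v \<phi>)"


section \<open>Existentially closed CBSes\<close>

text \<open>
  An extension of \<open>A\<close> is a CBS \<open>B\<close> together with an embedding \<open>e\<close> of \<open>A\<close> into \<open>B\<close>; a parameter
  \<open>p\<close> then denotes \<open>e p\<close> in \<open>B\<close>. Since a formula cannot quantify over types, the extensions
  considered have their carriers in a given type \<open>'b\<close>, passed as a type argument.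
\<close>

definition existentially_closed :: "'b itself \<Rightarrow> 'a gorder \<Rightarrow> bool" where
  "existentially_closed (_ :: 'b itself) A \<longleftrightarrow>
    (\<forall>(B :: 'b gorder) e \<phi>.
      co_brouwerian_semilattice B \<longrightarrow> cbs_embedding e A B \<longrightarrow>
      existential_sentence (carrier A) \<phi> \<longrightarrow> true_in B e \<phi> \<longrightarrow>
      true_in A (\<lambda>p. p) \<phi>)"

end

theory Submission
  imports Defs
begin

text \<open>If finite extensions embed, an existential sentence true in an extension \<open>B\<close> of \<open>L\<close> already
  holds in the sub-CBS of \<open>B\<close> generated by its parameters and witnesses, which is finite because
  CBSes are locally finite, and this finite CBS embeds into \<open>L\<close> over the sub-CBS of \<open>L\<close> generated
  by the parameters. Conversely, a finite extension \<open>C\<close> of \<open>L0\<close> can be amalgamated with \<open>L\<close> over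
  \<open>L0\<close>; the diagram of \<open>C\<close> is then an existential sentence true in an extension of \<open>L\<close>, and a
  solution in \<open>L\<close> is an embedding of \<open>C\<close> over \<open>L0\<close>. The amalgam is cut down to a generated sub-CBS
  so that its carrier fits into the given type.\<close>

section \<open>Local finiteness\<close>

inductive_set generated :: "('a, 'm) gorder_scheme \<Rightarrow> 'a set \<Rightarrow> 'a set"
  for L (structure) and X where
  base: "x \<in> X \<Longrightarrow> x \<in> generated L X"
| zero: "\<bottom> \<in> generated L X"
| join: "\<lbrakk>a \<in> generated L X; b \<in> generated L X\<rbrakk> \<Longrightarrow> a \<squnion> b \<in> generated L X"
| diff: "\<lbrakk>a \<in> generated L X; b \<in> generated L X\<rbrakk> \<Longrightarrow> a \<setminus> b \<in> generated L X"

lemma generated_mono: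
  assumes "X \<subseteq> Y"
  shows "generated L X \<subseteq> generated L Y"
proof
  fix x assume "x \<in> generated L X"
  then show "x \<in> generated L Y"
    by induction (use assms in \<open>auto intro: generated.intros\<close>)
qed

context co_brouwerian_semilattice
begin

declare diff_closed [simp, intro]

lemma generated_closed:
  assumes "X \<subseteq> carrier L"
  shows "generated L X \<subseteq> carrier L"
proof
  fix x assume "x \<in> generated L X"
  then show "x \<in> carrier L"
    by induction (use assms in auto)
qed

lemma sub_cbs_generated:
  assumes "X \<subseteq> carrier L"
  shows "sub_cbs (generated L X) L"
  using generated_closed[OF assms] by (auto simp: sub_cbs_def intro: generated.intros)

lemma join_le_iff:
  assumes "x \<in> carrier L" "y \<in> carrier L" "z \<in> carrier L"
  shows "x \<squnion> y \<sqsubseteq> z \<longleftrightarrow> x \<sqsubseteq> z \<and> y \<sqsubseteq> z"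
  using assms by (meson join_closed join_le join_left join_right le_trans)

lemma le_joinI1:
  assumes "x \<in> carrier L" "y \<in> carrier L" "z \<in> carrier L" "x \<sqsubseteq> y"
  shows "x \<sqsubseteq> y \<squnion> z"
  using assms by (meson join_closed join_left le_trans)

lemma le_joinI2:
  assumes "x \<in> carrier L" "y \<in> carrier L" "z \<in> carrier L" "x \<sqsubseteq> z"
  shows "x \<sqsubseteq> y \<squnion> z"
  using assms by (meson join_closed join_right le_trans)

lemma le_bot_iff: "x \<in> carrier L \<Longrightarrow> x \<sqsubseteq> \<bottom> \<longleftrightarrow> x = \<bottom>"
  by (meson bottom_closed bottom_lower le_antisym le_refl)

lemma join_assoc:
  assumes "x \<in> carrier L" "y \<in> carrier L" "z \<in> carrier L"
  shows "(x \<squnion> y) \<squnion> z = x \<squnion> (y \<squnion> z)"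
  using assms weak_join_assoc eq_is_equal by auto

lemma bot_join: "x \<in> carrier L \<Longrightarrow> \<bottom> \<squnion> x = x"
  by (intro le_antisym) (auto simp: join_le_iff join_right)

lemma join_bot: "x \<in> carrier L \<Longrightarrow> x \<squnion> \<bottom> = x"
  using bot_join join_comm by metis

lemma diff_eq_bot_iff:
  assumes "x \<in> carrier L" "y \<in> carrier L"
  shows "x \<setminus> y = \<bottom> \<longleftrightarrow> x \<sqsubseteq> y"
  using assms diff_le_iff[of x y \<bottom>] by (simp add: le_bot_iff join_bot)

lemma le_join_diff:
  assumes "x \<in> carrier L" "y \<in> carrier L"
  shows "x \<sqsubseteq> y \<squnion> (x \<setminus> y)"
  using assms diff_le_iff[of x y "x \<setminus> y"] by simp

section \<open>Ideals and the congruences they induce\<close>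

definition cbs_ideal :: "'a set \<Rightarrow> bool" where
  "cbs_ideal I \<longleftrightarrow> I \<subseteq> carrier L \<and> \<bottom> \<in> I \<and> (\<forall>x\<in>I. \<forall>y\<in>I. x \<squnion> y \<in> I) \<and>
    (\<forall>x\<in>carrier L. \<forall>y\<in>I. x \<sqsubseteq> y \<longrightarrow> x \<in> I)"

text \<open>The order of the quotient by \<open>I\<close>, pulled back to representatives so that no
  quotient structure has to be formed. For an ideal \<open>I\<close> and elements of the carrier it
  says that \<open>s \<setminus> t\<close> belongs to \<open>I\<close>.\<close>

definition le_mod :: "'a set \<Rightarrow> 'a \<Rightarrow> 'a \<Rightarrow> bool" where
  "le_mod I s t \<longleftrightarrow> (\<exists>i\<in>I. s \<sqsubseteq> t \<squnion> i)"

definition eq_mod :: "'a set \<Rightarrow> 'a \<Rightarrow> 'a \<Rightarrow> bool" where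
  "eq_mod I s t \<longleftrightarrow> le_mod I s t \<and> le_mod I t s"

lemma cbs_idealD:
  assumes "cbs_ideal I"
  shows "x \<in> I \<Longrightarrow> x \<in> carrier L" "\<bottom> \<in> I" "\<lbrakk>x \<in> I; y \<in> I\<rbrakk> \<Longrightarrow> x \<squnion> y \<in> I"
    "\<lbrakk>x \<in> carrier L; y \<in> I; x \<sqsubseteq> y\<rbrakk> \<Longrightarrow> x \<in> I"
  using assms by (auto simp: cbs_ideal_def)

lemma cbs_ideal_bot: "cbs_ideal {\<bottom>}"
  by (auto simp: cbs_ideal_def le_bot_iff bot_join)

context
  fixes I assumes I: "cbs_ideal I"
begin

lemma le_mod_le: "\<lbrakk>s \<in> carrier L; t \<in> carrier L; s \<sqsubseteq> t\<rbrakk> \<Longrightarrow> le_mod I s t"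
  unfolding le_mod_def using cbs_idealD[OF I] by (metis join_bot)

lemma le_mod_bot_iff: "s \<in> carrier L \<Longrightarrow> le_mod I s \<bottom> \<longleftrightarrow> s \<in> I"
  unfolding le_mod_def using cbs_idealD[OF I] by (metis bot_join le_refl)

lemma le_mod_member: "\<lbrakk>i \<in> I; t \<in> carrier L\<rbrakk> \<Longrightarrow> le_mod I i t"
  unfolding le_mod_def using cbs_idealD(1)[OF I] join_right by blast

lemma le_mod_trans:
  assumes "s \<in> carrier L" "t \<in> carrier L" "u \<in> carrier L" "le_mod I s t" "le_mod I t u"
  shows "le_mod I s u"
proof -
  obtain i j where ij: "i \<in> I" "j \<in> I" "s \<sqsubseteq> t \<squnion> i" "t \<sqsubseteq> u \<squnion> j"
    using assms by (auto simp: le_mod_def)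
  then have c: "i \<in> carrier L" "j \<in> carrier L" using cbs_idealD(1)[OF I] by auto
  have "t \<squnion> i \<sqsubseteq> (u \<squnion> j) \<squnion> i"
    using assms c ij by (simp add: join_le_iff le_joinI1 le_joinI2)
  then have "s \<sqsubseteq> u \<squnion> (j \<squnion> i)"
    using assms c ij le_trans[of s "t \<squnion> i"] by (simp add: join_assoc)
  then show ?thesis unfolding le_mod_def using ij cbs_idealD[OF I] by blast
qed

lemma le_mod_join_iff:
  assumes "s \<in> carrier L" "t \<in> carrier L" "u \<in> carrier L"
  shows "le_mod I (s \<squnion> t) u \<longleftrightarrow> le_mod I s u \<and> le_mod I t u"
proof
  assume "le_mod I s u \<and> le_mod I t u"
  then obtain i j where ij: "i \<in> I" "j \<in> I" "s \<sqsubseteq> u \<squnion> i" "t \<sqsubseteq> u \<squnion> j"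
    by (auto simp: le_mod_def)
  then have c: "i \<in> carrier L" "j \<in> carrier L" using cbs_idealD(1)[OF I] by auto
  have "s \<sqsubseteq> u \<squnion> (i \<squnion> j)"
    using ij c assms le_joinI1[of s "u \<squnion> i" j] by (simp add: join_assoc)
  moreover have "t \<sqsubseteq> u \<squnion> (i \<squnion> j)"
    using ij c assms le_joinI1[of t "u \<squnion> j" i] join_comm[of L i j] by (simp add: join_assoc)
  ultimately show "le_mod I (s \<squnion> t) u"
    unfolding le_mod_def using ij c assms cbs_idealD(3)[OF I, of i j]
    by (intro bexI[of _ "i \<squnion> j"]) (simp_all add: join_le_iff)
qed (use assms cbs_idealD(1)[OF I] in \<open>auto simp: le_mod_def join_le_iff\<close>)

text \<open>By associativity of the join, the same element of \<open>I\<close> witnesses both sides.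
  Thus the adjunction that defines differences passes to the quotient.\<close>

lemma le_mod_diff_iff:
  assumes "s \<in> carrier L" "t \<in> carrier L" "u \<in> carrier L"
  shows "le_mod I (s \<setminus> t) u \<longleftrightarrow> le_mod I s (t \<squnion> u)"
  unfolding le_mod_def
  using assms cbs_idealD(1)[OF I] by (auto simp: diff_le_iff join_assoc)

lemma le_mod_joinI1:
  "\<lbrakk>s \<in> carrier L; t \<in> carrier L; u \<in> carrier L; le_mod I s t\<rbrakk> \<Longrightarrow> le_mod I s (t \<squnion> u)"
  by (meson join_closed join_left le_mod_le le_mod_trans)

lemma le_mod_joinI2:
  "\<lbrakk>s \<in> carrier L; t \<in> carrier L; u \<in> carrier L; le_mod I s u\<rbrakk> \<Longrightarrow> le_mod I s (t \<squnion> u)"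
  by (meson join_closed join_right le_mod_le le_mod_trans)

lemma eq_mod_refl: "s \<in> carrier L \<Longrightarrow> eq_mod I s s"
  by (simp add: eq_mod_def le_mod_le)

lemma eq_mod_sym: "eq_mod I s t \<Longrightarrow> eq_mod I t s"
  by (simp add: eq_mod_def)

lemma eq_mod_trans:
  "\<lbrakk>s \<in> carrier L; t \<in> carrier L; u \<in> carrier L; eq_mod I s t; eq_mod I t u\<rbrakk> \<Longrightarrow> eq_mod I s u"
  unfolding eq_mod_def using le_mod_trans by blast

lemma le_mod_join_mono:
  assumes "s \<in> carrier L" "t \<in> carrier L" "s' \<in> carrier L" "t' \<in> carrier L"
    "le_mod I s s'" "le_mod I t t'"
  shows "le_mod I (s \<squnion> t) (s' \<squnion> t')"
  using assms by (simp add: le_mod_join_iff le_mod_joinI1 le_mod_joinI2)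

lemma le_mod_diff_mono:
  assumes "s \<in> carrier L" "t \<in> carrier L" "s' \<in> carrier L" "t' \<in> carrier L"
    "le_mod I s s'" "le_mod I t' t"
  shows "le_mod I (s \<setminus> t) (s' \<setminus> t')"
proof -
  \<comment> \<open>By the adjunction the goal becomes \<open>s\<close> below
    \<open>t \<squnion> (s' \<setminus> t')\<close> modulo \<open>I\<close>, which is reached
    through \<open>s'\<close> and \<open>t' \<squnion> (s' \<setminus> t')\<close>.\<close>
  have "le_mod I s' (t' \<squnion> (s' \<setminus> t'))"
    using assms by (simp add: le_join_diff le_mod_le)
  moreover have "le_mod I (t' \<squnion> (s' \<setminus> t')) (t \<squnion> (s' \<setminus> t'))"
    using assms by (intro le_mod_join_mono) (auto intro: le_mod_le)
  ultimately show ?thesis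
    using assms le_mod_trans[of s s' "t' \<squnion> (s' \<setminus> t')"]
      le_mod_trans[of s "t' \<squnion> (s' \<setminus> t')" "t \<squnion> (s' \<setminus> t')"]
    by (simp add: le_mod_diff_iff)
qed

lemma eq_mod_join:
  assumes "s \<in> carrier L" "t \<in> carrier L" "s' \<in> carrier L" "t' \<in> carrier L"
    "eq_mod I s s'" "eq_mod I t t'"
  shows "eq_mod I (s \<squnion> t) (s' \<squnion> t')"
  using assms by (simp add: eq_mod_def le_mod_join_mono)

lemma eq_mod_diff:
  assumes "s \<in> carrier L" "t \<in> carrier L" "s' \<in> carrier L" "t' \<in> carrier L"
    "eq_mod I s s'" "eq_mod I t t'"
  shows "eq_mod I (s \<setminus> t) (s' \<setminus> t')"
  using assms by (simp add: eq_mod_def le_mod_diff_mono)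

text \<open>This set is the ideal generated by \<open>I\<close> and \<open>d\<close>; it is the
  means by which ideals are enlarged throughout.\<close>

lemma cbs_ideal_le_mod:
  assumes d: "d \<in> carrier L"
  shows "cbs_ideal {w \<in> carrier L. le_mod I w d}"
proof -
  have "le_mod I x d" if "x \<in> carrier L" "y \<in> carrier L" "le_mod I y d" "x \<sqsubseteq> y" for x y
    using that d le_mod_trans[of x y d] by (simp add: le_mod_le)
  then show ?thesis
    unfolding cbs_ideal_def using d by (auto simp: le_mod_join_iff le_mod_le)
qed

text \<open>Every element of the enlarged ideal is bounded by \<open>d\<close> modulo
  \<open>I\<close>, so it may be replaced by \<open>d\<close> itself. Passing to the quotient by the
  enlarged ideal thus amounts to ignoring a joinand \<open>d\<close> on the right.\<close>

lemma le_mod_adjoin_iff: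
  assumes "s \<in> carrier L" "t \<in> carrier L" "d \<in> carrier L"
  shows "le_mod {w \<in> carrier L. le_mod I w d} s t \<longleftrightarrow> le_mod I s (t \<squnion> d)"
proof
  assume "le_mod {w \<in> carrier L. le_mod I w d} s t"
  then obtain w where w: "w \<in> carrier L" "le_mod I w d" "s \<sqsubseteq> t \<squnion> w"
    unfolding le_mod_def[of "{w \<in> carrier L. le_mod I w d}"] by blast
  have "le_mod I (t \<squnion> w) (t \<squnion> d)"
    using assms w by (intro le_mod_join_mono) (auto intro: le_mod_le)
  then show "le_mod I s (t \<squnion> d)"
    using assms w le_mod_trans[of s "t \<squnion> w" "t \<squnion> d"] by (simp add: le_mod_le)
next
  assume "le_mod I s (t \<squnion> d)"
  then obtain i where "i \<in> I" "s \<sqsubseteq> t \<squnion> d \<squnion> i" by (auto simp: le_mod_def)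
  moreover from this have "i \<in> carrier L" using cbs_idealD(1)[OF I] by auto
  \<comment> \<open>This puts \<open>d \<squnion> i\<close> into the enlarged ideal, where it serves
    as the witness.\<close>
  moreover from calculation have "le_mod I (d \<squnion> i) d"
    using assms by (auto simp: le_mod_def join_right intro!: bexI[of _ i])
  ultimately show "le_mod {w \<in> carrier L. le_mod I w d} s t"
    using assms unfolding le_mod_def[of _ s t]
    by (intro bexI[of _ "d \<squnion> i"]) (auto simp: join_assoc)
qed

end

section \<open>Ideals maximal with respect to avoiding an element\<close>

definition maximal_avoiding :: "'a \<Rightarrow> 'a set \<Rightarrow> bool" where
  "maximal_avoiding d I \<longleftrightarrow> cbs_ideal I \<and> d \<notin> I \<and> (\<forall>w\<in>carrier L. w \<notin> I \<longrightarrow> le_mod I d w)"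

text \<open>Zorn's lemma applies because the union of a nonempty chain of ideals avoiding
  \<open>d\<close> is again such an ideal. The last clause of \<open>maximal_avoiding\<close>
  restates maximality elementwise: adjoining any \<open>w\<close> outside \<open>I\<close> brings
  \<open>d\<close> into the ideal.\<close>

lemma maximal_avoiding_exists:
  assumes d: "d \<in> carrier L" "d \<noteq> \<bottom>"
  obtains I where "maximal_avoiding d I"
proof -
  let ?A = "{I. cbs_ideal I \<and> d \<notin> I}"
  have "\<exists>M\<in>?A. \<forall>X\<in>?A. M \<subseteq> X \<longrightarrow> X = M"
  proof (rule subset_Zorn_nonempty)
    show "?A \<noteq> {}" using cbs_ideal_bot d by blast
    fix C assume C: "C \<noteq> {}" "subset.chain ?A C"
    have ideal: "cbs_ideal I" "d \<notin> I" if "I \<in> C" for I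
      using C that by (auto simp: subset.chain_def)
    have "x \<squnion> y \<in> \<Union>C" if xy: "x \<in> I" "I \<in> C" "y \<in> J" "J \<in> C" for x y I J
    proof -
      have "I \<subseteq> J \<or> J \<subseteq> I" using C xy by (auto simp: subset.chain_def)
      then show ?thesis using xy cbs_idealD(3)[OF ideal(1)] by blast
    qed
    moreover have "\<bottom> \<in> \<Union>C" using C ideal cbs_idealD(2) by auto
    moreover have "\<Union>C \<subseteq> carrier L" using cbs_idealD(1)[OF ideal(1)] by blast
    moreover have "x \<in> \<Union>C" if "x \<in> carrier L" "y \<in> \<Union>C" "x \<sqsubseteq> y" for x y
      using that cbs_idealD(4)[OF ideal(1)] by blast
    ultimately have "cbs_ideal (\<Union>C)" unfolding cbs_ideal_def by blast
    then show "\<Union>C \<in> ?A" using ideal by auto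
  qed
  then obtain M where M: "cbs_ideal M" "d \<notin> M"
    and max: "\<And>X. \<lbrakk>cbs_ideal X; d \<notin> X; M \<subseteq> X\<rbrakk> \<Longrightarrow> X = M"
    by auto
  have "le_mod M d w" if w: "w \<in> carrier L" "w \<notin> M" for w
  proof (rule ccontr)
    assume n: "\<not> le_mod M d w"
    \<comment> \<open>The ideal generated by \<open>M\<close> and \<open>w\<close> still avoids
      \<open>d\<close>, so maximality makes it equal to \<open>M\<close>, although it contains
      \<open>w\<close>.\<close>
    have "{v \<in> carrier L. le_mod M v w} = M"
    proof (rule max)
      show "cbs_ideal {v \<in> carrier L. le_mod M v w}" using M w by (simp add: cbs_ideal_le_mod)
      show "M \<subseteq> {v \<in> carrier L. le_mod M v w}"
        using w cbs_idealD(1)[OF M(1)] le_mod_member[OF M(1)] by auto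
    qed (use n in auto)
    then show False using w le_mod_le[OF M(1)] by auto
  qed
  then show thesis using M that by (auto simp: maximal_avoiding_def)
qed

text \<open>In the quotient by an ideal maximal with respect to avoiding \<open>d\<close>, the class of \<open>d\<close> is the
  least nonzero element; as the other elements are closed under the operations, it is the class
  of a generator.\<close>

lemma maximal_avoiding_generator:
  assumes I: "maximal_avoiding d I" and X: "X \<subseteq> carrier L" and d: "d \<in> generated L X"
  shows "\<exists>x\<in>X. eq_mod I x d"
proof (rule ccontr)
  assume n: "\<not> (\<exists>x\<in>X. eq_mod I x d)"
  have id: "cbs_ideal I" and dI: "d \<notin> I"
    and min: "\<And>w. \<lbrakk>w \<in> carrier L; w \<notin> I\<rbrakk> \<Longrightarrow> le_mod I d w"
    using I by (auto simp: maximal_avoiding_def)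
  have dc: "d \<in> carrier L" using generated_closed[OF X] d by auto
  \<comment> \<open>Outside \<open>I\<close> everything lies above \<open>d\<close> modulo
    \<open>I\<close>, so an element strictly below \<open>d\<close> has to be null.\<close>
  have below: "w \<in> I" if "w \<in> carrier L" "le_mod I w d" "\<not> eq_mod I w d" for w
    using that min by (auto simp: eq_mod_def)
  have c: "s \<in> carrier L" if "s \<in> generated L X" for s
    using generated_closed[OF X] that by auto
  have "\<not> eq_mod I s d" if "s \<in> generated L X" for s
    using that
  proof induction
    case zero
    then show ?case using le_mod_bot_iff[OF id dc] dI by (auto simp: eq_mod_def)
  next
    case (join a b)
    have ab: "a \<in> carrier L" "b \<in> carrier L" using join c by auto
    show ?case
    proof
      assume e: "eq_mod I (a \<squnion> b) d"
      then have "a \<in> I" "b \<in> I"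
        using join ab dc by (auto simp: eq_mod_def le_mod_join_iff[OF id] intro: below)
      then have "a \<squnion> b \<in> I" using cbs_idealD(3)[OF id] by auto
      then have "le_mod I (a \<squnion> b) \<bottom>" using le_mod_bot_iff[OF id] ab by auto
      then have "le_mod I d \<bottom>"
        using e ab dc by (auto simp: eq_mod_def intro: le_mod_trans[OF id, of d "a \<squnion> b"])
      then show False using le_mod_bot_iff[OF id dc] dI by auto
    qed
  next
    case (diff a b)
    have ab: "a \<in> carrier L" "b \<in> carrier L" using diff c by auto
    show ?case
    proof
      assume e: "eq_mod I (a \<setminus> b) d"
      then have abd: "le_mod I a (b \<squnion> d)"
        using ab dc by (simp add: eq_mod_def le_mod_diff_iff[OF id])
      show False
      \<comment> \<open>If \<open>b\<close> is null, then \<open>a \<setminus> b\<close> is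
        congruent to \<open>a\<close>, which the induction hypothesis excludes. Otherwise
        \<open>b\<close> absorbs \<open>d\<close>, so \<open>a\<close> lies below \<open>b\<close>
        and \<open>a \<setminus> b\<close> is null, unlike \<open>d\<close>.\<close>
      proof (cases "b \<in> I")
        case True
        then have b: "eq_mod I b \<bottom>"
          using ab le_mod_bot_iff[OF id] le_mod_le[OF id] by (auto simp: eq_mod_def)
        have "eq_mod I (a \<setminus> b) (a \<setminus> \<bottom>)"
          using ab b by (intro eq_mod_diff[OF id] eq_mod_refl[OF id]) auto
        moreover have "a \<setminus> \<bottom> = a"
          using ab by (intro diff_unique) (auto simp: bot_join)
        ultimately show False
          using e ab dc diff eq_mod_trans[OF id, of a "a \<setminus> b" d] eq_mod_sym[OF id] by auto
      next
        case False
        then have "le_mod I d b" using min ab by auto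
        then have "le_mod I (b \<squnion> d) b"
          using ab dc by (simp add: le_mod_join_iff[OF id] le_mod_le[OF id])
        then have "le_mod I a b" using abd ab dc le_mod_trans[OF id, of a "b \<squnion> d" b] by auto
        then have "le_mod I (a \<setminus> b) \<bottom>"
          using ab by (simp add: le_mod_diff_iff[OF id] join_bot)
        then have "le_mod I d \<bottom>"
          using e ab dc by (auto simp: eq_mod_def intro: le_mod_trans[OF id, of d "a \<setminus> b"])
        then show False using le_mod_bot_iff[OF id dc] dI by auto
      qed
    qed
  qed (use n in blast)
  then show False using d eq_mod_refl[OF id dc] by blast
qed

text \<open>The generator \<open>x\<close> is congruent to zero, so it can be replaced by
  \<open>\<bottom>\<close> wherever it is used in generating \<open>s\<close>.\<close>

lemma generated_omit_null_generator:
  assumes I: "cbs_ideal I" and X: "X \<subseteq> carrier L" and x: "x \<in> I" and s: "s \<in> generated L X"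
  shows "\<exists>r\<in>generated L (X - {x}). eq_mod I s r"
proof -
  have c: "s \<in> carrier L" if "s \<in> generated L X" for s
    using generated_closed[OF X] that by auto
  have c': "s \<in> carrier L" if "s \<in> generated L (X - {x})" for s
    using generated_closed[of "X - {x}"] X that by auto
  show ?thesis using s
  proof induction
    case (base y)
    show ?case
    proof (cases "y = x")
      case True
      then have "eq_mod I y \<bottom>"
        using x cbs_idealD(1)[OF I] by (auto simp: eq_mod_def le_mod_bot_iff[OF I] le_mod_le[OF I])
      then show ?thesis using generated.zero by blast
    next
      case False
      then show ?thesis using base X eq_mod_refl[OF I] by (meson DiffI generated.base singletonD subsetD)
    qed
  next
    case zero
    then show ?case using generated.zero eq_mod_refl[OF I bottom_closed] by blast
  next
    case (join a b)
    then show ?case by (meson c c' generated.join eq_mod_join[OF I])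
  next
    case (diff a b)
    then show ?case by (meson c c' generated.diff eq_mod_diff[OF I])
  qed
qed

text \<open>Some generator \<open>x\<close> is congruent to \<open>d\<close>. Adjoining
  \<open>d\<close> to the ideal kills \<open>x\<close>, which leaves a representative generated by
  fewer elements. Little is lost by this step: \<open>d\<close> is the least nonzero class, so only
  the classes of \<open>d\<close> and \<open>\<bottom>\<close> get identified.\<close>

lemma maximal_avoiding_representative:
  assumes I: "maximal_avoiding d I" and X: "X \<subseteq> carrier L" and d: "d \<in> generated L X"
    and s: "s \<in> generated L X"
  shows "\<exists>g\<in>insert \<bottom> (X \<union> (\<Union>x\<in>X. generated L (X - {x}))). eq_mod I s g"
proof -
  have id: "cbs_ideal I" and dI: "d \<notin> I"
    and min: "\<And>w. \<lbrakk>w \<in> carrier L; w \<notin> I\<rbrakk> \<Longrightarrow> le_mod I d w"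
    using I by (auto simp: maximal_avoiding_def)
  have dc: "d \<in> carrier L" and sc: "s \<in> carrier L" using generated_closed[OF X] d s by auto
  obtain x where x: "x \<in> X" "eq_mod I x d" using maximal_avoiding_generator[OF I X d] by auto
  then have xc: "x \<in> carrier L" using X by auto
  let ?J = "{w \<in> carrier L. le_mod I w d}"
  have J: "cbs_ideal ?J" using cbs_ideal_le_mod[OF id dc] .
  obtain r where r: "r \<in> generated L (X - {x})" "eq_mod ?J s r"
    using generated_omit_null_generator[OF J X _ s] x xc by (auto simp: eq_mod_def)
  have rc: "r \<in> carrier L" using r generated_closed[of "X - {x}"] X by auto
  have sr: "le_mod I s (r \<squnion> d)" "le_mod I r (s \<squnion> d)"
    using r sc rc dc by (auto simp: eq_mod_def le_mod_adjoin_iff[OF id])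
  \<comment> \<open>Since \<open>d\<close> lies below every \<open>v\<close> outside
    \<open>I\<close>, joining \<open>d\<close> to such a \<open>v\<close> changes nothing modulo
    \<open>I\<close>.\<close>
  have absorb: "le_mod I u v" if "u \<in> carrier L" "v \<in> carrier L" "v \<notin> I" "le_mod I u (v \<squnion> d)" for u v
  proof -
    have "le_mod I (v \<squnion> d) v"
      using that min dc by (simp add: le_mod_join_iff[OF id] le_mod_le[OF id])
    then show ?thesis using that dc le_mod_trans[OF id, of u "v \<squnion> d" v] by auto
  qed
  \<comment> \<open>The representatives in the three cases are \<open>\<bottom>\<close>, the
    generator \<open>x\<close>, and \<open>r\<close>. In the second case \<open>s\<close> is nonzero
    and lies below \<open>d\<close>, hence is congruent to \<open>d\<close> and to
    \<open>x\<close>.\<close>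
  consider "s \<in> I" | "s \<notin> I" "r \<in> I" | "s \<notin> I" "r \<notin> I" by blast
  then show ?thesis
  proof cases
    case 1
    then have "eq_mod I s \<bottom>"
      using sc by (auto simp: eq_mod_def le_mod_bot_iff[OF id] le_mod_le[OF id])
    then show ?thesis by blast
  next
    case 2
    have "le_mod I r d"
      using 2 dc le_mod_member[OF id] by auto
    then have "le_mod I (r \<squnion> d) d"
      using rc dc by (simp add: le_mod_join_iff[OF id] le_mod_le[OF id])
    then have "le_mod I s d" using sr sc rc dc le_mod_trans[OF id, of s "r \<squnion> d" d] by auto
    then have "eq_mod I s d" using 2 min sc by (auto simp: eq_mod_def)
    then have "eq_mod I s x" using x sc xc dc eq_mod_trans[OF id, of s d x] eq_mod_sym[OF id] by auto
    then show ?thesis using x by blast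
  next
    case 3
    then have "eq_mod I s r" using absorb sr sc rc by (auto simp: eq_mod_def)
    then show ?thesis using r x by blast
  qed
qed

text \<open>Local finiteness, by the argument of Diego for implicative semilattices: a maximal ideal
  avoiding some \<open>d\<close> sends every generated element to one of finitely many representatives \<open>G\<close>, and
  the induced congruence is determined by its restriction to a finite set \<open>H\<close>. Hence an element is
  determined by its finite set of pairs (restricted congruence, representative).\<close>

theorem finite_generated:
  assumes "finite X" "X \<subseteq> carrier L"
  shows "finite (generated L X)"
  using assms
proof (induction X rule: finite_psubset_induct)
  case (psubset X)
  \<comment> \<open>These are the representatives supplied by
    \<open>maximal_avoiding_representative\<close>; the induction hypothesis for the sets
    \<open>X - {x}\<close> makes them finite in number.\<close>
  define G where "G = insert \<bottom> (X \<union> (\<Union>x\<in>X. generated L (X - {x})))"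
  \<comment> \<open>One application of each operation to representatives suffices to record how the
    operations act on their classes.\<close>
  define H where "H = G \<union> (\<lambda>(a, b). a \<squnion> b) ` (G \<times> G) \<union> (\<lambda>(a, b). a \<setminus> b) ` (G \<times> G)"
  define R where "R I = {(a, b). eq_mod I a b} \<inter> H \<times> H" for I
  define M where "M = {I. \<exists>d\<in>generated L X. maximal_avoiding d I}"
  define \<tau> where "\<tau> s = {(R I, g) | I g. I \<in> M \<and> g \<in> G \<and> eq_mod I s g}" for s
  have "finite (generated L (X - {x}))" if "x \<in> X" for x
    using psubset that by (intro psubset.IH) auto
  then have G: "finite G" using psubset.hyps by (simp add: G_def)
  then have H: "finite H" by (simp add: H_def)
  have X: "X \<subseteq> carrier L" by fact
  have gX: "generated L X \<subseteq> carrier L" using generated_closed[OF X] .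
  have GX: "G \<subseteq> generated L X"
    using generated_mono[of "X - {_}" X L] by (auto simp: G_def intro: generated.intros)
  have HX: "H \<subseteq> generated L X" using GX by (auto simp: H_def intro: generated.intros)
  have id: "cbs_ideal I" if "I \<in> M" for I using that by (auto simp: M_def maximal_avoiding_def)
  have rep: "\<exists>g\<in>G. eq_mod I s g" if "I \<in> M" "s \<in> generated L X" for I s
    using maximal_avoiding_representative[OF _ X] that by (auto simp: M_def G_def)
  \<comment> \<open>Ideals with equal restricted congruences choose the same representatives. In the
    induction, an operation applied to two common representatives lands in \<open>H\<close>, and
    there \<open>R\<close> decides which element of \<open>G\<close> it reduces to, for both ideals
    at once.\<close>
  have common: "\<exists>g\<in>G. eq_mod I s g \<and> eq_mod J s g"
    if I: "I \<in> M" and J: "J \<in> M" and IJ: "R I = R J" and s: "s \<in> generated L X" for I J s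
  proof -
    have step: "\<exists>g\<in>G. eq_mod I u g \<and> eq_mod J u g"
      if h: "h \<in> H" "eq_mod I u h" "eq_mod J u h" and u: "u \<in> generated L X" for u h
    proof -
      obtain g where g: "g \<in> G" "eq_mod I h g" using rep[OF I] h HX by auto
      then have "(h, g) \<in> R I" using h by (auto simp: R_def H_def)
      then have "eq_mod J h g" using IJ by (auto simp: R_def)
      moreover have "u \<in> carrier L" "h \<in> carrier L" "g \<in> carrier L" using u h g HX GX gX by auto
      ultimately show ?thesis
        using g h eq_mod_trans[OF id[OF I], of u h g] eq_mod_trans[OF id[OF J], of u h g] by blast
    qed
    show ?thesis using s
    proof induction
      case (base x)
      then show ?case
        using eq_mod_refl[OF id[OF I]] eq_mod_refl[OF id[OF J]] X by (auto simp: G_def)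
    next
      case zero
      then show ?case
        using eq_mod_refl[OF id[OF I]] eq_mod_refl[OF id[OF J]] by (auto simp: G_def)
    next
      case (join a b)
      then obtain g h where gh: "g \<in> G" "eq_mod I a g" "eq_mod J a g" "h \<in> G" "eq_mod I b h" "eq_mod J b h"
        by auto
      have "a \<in> carrier L" "b \<in> carrier L" "g \<in> carrier L" "h \<in> carrier L" using join gh GX gX by auto
      with gh have "eq_mod I (a \<squnion> b) (g \<squnion> h)" "eq_mod J (a \<squnion> b) (g \<squnion> h)"
        using eq_mod_join[OF id[OF I]] eq_mod_join[OF id[OF J]] by auto
      then show ?case using gh join by (intro step[of "g \<squnion> h"]) (auto simp: H_def intro: generated.join)
    next
      case (diff a b)
      then obtain g h where gh: "g \<in> G" "eq_mod I a g" "eq_mod J a g" "h \<in> G" "eq_mod I b h" "eq_mod J b h"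
        by auto
      have "a \<in> carrier L" "b \<in> carrier L" "g \<in> carrier L" "h \<in> carrier L" using diff gh GX gX by auto
      with gh have "eq_mod I (a \<setminus> b) (g \<setminus> h)" "eq_mod J (a \<setminus> b) (g \<setminus> h)"
        using eq_mod_diff[OF id[OF I]] eq_mod_diff[OF id[OF J]] by auto
      then show ?case using gh diff by (intro step[of "g \<setminus> h"]) (auto simp: H_def intro: generated.diff)
    qed
  qed
  \<comment> \<open>If \<open>s\<close> is not below \<open>t\<close>, then
    \<open>s \<setminus> t\<close> is nonzero, and an ideal maximal in avoiding it keeps
    \<open>s\<close> and \<open>t\<close> incongruent. Equality of \<open>\<tau> s\<close> and
    \<open>\<tau> t\<close> contradicts this.\<close>
  have le: "s \<sqsubseteq> t" if s: "s \<in> generated L X" and t: "t \<in> generated L X" and st: "\<tau> s = \<tau> t" for s t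
  proof (rule ccontr)
    assume n: "\<not> s \<sqsubseteq> t"
    have c: "s \<in> carrier L" "t \<in> carrier L" using s t gX by auto
    then have "s \<setminus> t \<noteq> \<bottom>" using n diff_eq_bot_iff by auto
    then obtain I where I: "maximal_avoiding (s \<setminus> t) I" using maximal_avoiding_exists c by blast
    then have IM: "I \<in> M" using s t by (auto simp: M_def intro: generated.diff)
    obtain g where g: "g \<in> G" "eq_mod I s g" using rep[OF IM s] by auto
    then have "(R I, g) \<in> \<tau> s" using IM by (auto simp: \<tau>_def)
    then have "(R I, g) \<in> \<tau> t" using st by simp
    then obtain J where J: "J \<in> M" "R I = R J" "eq_mod J t g" by (auto simp: \<tau>_def)
    \<comment> \<open>The ideal \<open>J\<close> may differ from \<open>I\<close>, but
      \<open>h\<close> represents \<open>t\<close> for both. The congruence of \<open>g\<close> and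
      \<open>h\<close> modulo \<open>J\<close> is recorded in \<open>R J\<close>, and so carries
      over to \<open>I\<close>.\<close>
    obtain h where h: "h \<in> G" "eq_mod I t h" "eq_mod J t h" using common[OF IM J(1,2) t] by auto
    have gh: "g \<in> carrier L" "h \<in> carrier L" using g h GX gX by auto
    have "eq_mod J g h"
      using eq_mod_trans[OF id[OF J(1)], of g t h] eq_mod_sym[OF id[OF J(1)]] J h gh c by auto
    then have "(g, h) \<in> R J" using g h by (auto simp: R_def H_def)
    then have "eq_mod I g h" using J by (auto simp: R_def)
    then have "eq_mod I s t"
      using g h gh c eq_mod_trans[OF id[OF IM], of s g h] eq_mod_trans[OF id[OF IM], of s h t]
        eq_mod_sym[OF id[OF IM]] by auto
    then have "le_mod I (s \<setminus> t) \<bottom>"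
      using c by (simp add: le_mod_diff_iff[OF id[OF IM]] join_bot eq_mod_def)
    then show False using I c le_mod_bot_iff[OF id[OF IM]] by (auto simp: maximal_avoiding_def)
  qed
  have "inj_on \<tau> (generated L X)"
    using gX by (intro inj_onI le_antisym le) auto
  moreover have "\<tau> ` generated L X \<subseteq> Pow (Pow (H \<times> H) \<times> G)"
    by (auto simp: \<tau>_def R_def)
  then have "finite (\<tau> ` generated L X)"
    using G H by (meson finite_Pow_iff finite_SigmaI finite_subset)
  ultimately show ?case using finite_imageD by blast
qed

end

section \<open>Presentations and embeddings\<close>

text \<open>A criterion for concrete constructions: once explicit operations satisfy these laws, the
  zero, join and difference that the order determines by definite description are identified with
  them.\<close>

locale cbs_operations =
  fixes A :: "'a set" and le :: "'a \<Rightarrow> 'a \<Rightarrow> bool" and j d :: "'a \<Rightarrow> 'a \<Rightarrow> 'a" and z :: 'a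
  assumes refl: "x \<in> A \<Longrightarrow> le x x"
    and antisym: "\<lbrakk>x \<in> A; y \<in> A; le x y; le y x\<rbrakk> \<Longrightarrow> x = y"
    and trans: "\<lbrakk>x \<in> A; y \<in> A; u \<in> A; le x y; le y u\<rbrakk> \<Longrightarrow> le x u"
    and zero: "z \<in> A" "x \<in> A \<Longrightarrow> le z x"
    and join: "\<lbrakk>x \<in> A; y \<in> A\<rbrakk> \<Longrightarrow> j x y \<in> A"
      "\<lbrakk>x \<in> A; y \<in> A\<rbrakk> \<Longrightarrow> le x (j x y)" "\<lbrakk>x \<in> A; y \<in> A\<rbrakk> \<Longrightarrow> le y (j x y)"
      "\<lbrakk>x \<in> A; y \<in> A; u \<in> A; le x u; le y u\<rbrakk> \<Longrightarrow> le (j x y) u"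
    and diff: "\<lbrakk>x \<in> A; y \<in> A\<rbrakk> \<Longrightarrow> d x y \<in> A"
      "\<lbrakk>x \<in> A; y \<in> A; u \<in> A\<rbrakk> \<Longrightarrow> le (d x y) u \<longleftrightarrow> le x (j y u)"
begin

lemma
  defines "S \<equiv> \<lparr>carrier = A, eq = (=), le = le\<rparr>"
  shows cbs: "co_brouwerian_semilattice S"
    and bottom_eq: "\<bottom>\<^bsub>S\<^esub> = z"
    and join_eq: "\<lbrakk>x \<in> A; y \<in> A\<rbrakk> \<Longrightarrow> x \<squnion>\<^bsub>S\<^esub> y = j x y"
    and diff_eq: "\<lbrakk>x \<in> A; y \<in> A\<rbrakk> \<Longrightarrow> x \<setminus>\<^bsub>S\<^esub> y = d x y"
proof -
  interpret S: partial_order S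
    by unfold_locales (auto simp: S_def intro: refl antisym trans)
  have lub: "least S (j x y) (Upper S {x, y})" if "x \<in> A" "y \<in> A" for x y
    using that join by (intro least_UpperI) (auto simp: Upper_def S_def)
  have bot: "least S z (carrier S)"
    using zero by (auto simp: least_def S_def)
  show bot_eq: "\<bottom>\<^bsub>S\<^esub> = z"
    unfolding bottom_def[of S] using bot by (blast intro: S.least_unique)
  have join_eq: "x \<squnion>\<^bsub>S\<^esub> y = j x y" if "x \<in> A" "y \<in> A" for x y
    unfolding join_def[of S] sup_def[of S]
    using lub[OF that] by (blast intro: S.least_unique)
  show "x \<squnion>\<^bsub>S\<^esub> y = j x y" if "x \<in> A" "y \<in> A" using join_eq that .
  interpret S: co_brouwerian_semilattice S
  proof unfold_locales
    show "\<exists>s. least S s (Upper S {x, y})" if "x \<in> carrier S" "y \<in> carrier S" for x y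
      using lub[of x y] that by (auto simp: S_def)
    show "\<exists>x. least S x (carrier S)" using bot by blast
    show "\<exists>e\<in>carrier S. \<forall>c\<in>carrier S. e \<sqsubseteq>\<^bsub>S\<^esub> c \<longleftrightarrow> a \<sqsubseteq>\<^bsub>S\<^esub> b \<squnion>\<^bsub>S\<^esub> c"
      if "a \<in> carrier S" "b \<in> carrier S" for a b
      using that diff join_eq by (intro bexI[of _ "d a b"]) (simp_all add: S_def)
  qed
  show "co_brouwerian_semilattice S" by (rule S.co_brouwerian_semilattice_axioms)
  show "x \<setminus>\<^bsub>S\<^esub> y = d x y" if "x \<in> A" "y \<in> A"
    using that diff join_eq by (intro S.diff_unique) (simp_all add: S_def)
qed

end

lemma cbs_embeddingD:
  assumes "cbs_embedding f A B"
  shows "a \<in> carrier A \<Longrightarrow> f a \<in> carrier B" "inj_on f (carrier A)" "f \<bottom>\<^bsub>A\<^esub> = \<bottom>\<^bsub>B\<^esub>"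
    "\<lbrakk>a \<in> carrier A; b \<in> carrier A\<rbrakk> \<Longrightarrow> f (a \<squnion>\<^bsub>A\<^esub> b) = f a \<squnion>\<^bsub>B\<^esub> f b"
    "\<lbrakk>a \<in> carrier A; b \<in> carrier A\<rbrakk> \<Longrightarrow> f (a \<setminus>\<^bsub>A\<^esub> b) = f a \<setminus>\<^bsub>B\<^esub> f b"
  using assms by (auto simp: cbs_embedding_def)

lemma cbs_embedding_comp:
  assumes "cbs_embedding f A B" "cbs_embedding g B C"
  shows "cbs_embedding (g \<circ> f) A C"
  using assms by (auto simp: cbs_embedding_def Pi_iff inj_on_def)

lemma cbs_embedding_cong:
  assumes "co_brouwerian_semilattice A" "cbs_embedding f A B"
    and "\<And>a. a \<in> carrier A \<Longrightarrow> g a = f a"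
  shows "cbs_embedding g A B"
proof -
  interpret A: co_brouwerian_semilattice A by fact
  show ?thesis
    using assms(2,3) by (auto simp: cbs_embedding_def Pi_iff inj_on_def)
qed

lemma cbs_embedding_into_sub_cbs:
  assumes "co_brouwerian_semilattice B" "cbs_embedding f A B" "sub_cbs S B" "f ` carrier A \<subseteq> S"
  shows "cbs_embedding f A (B\<lparr>carrier := S\<rparr>)"
proof -
  interpret co_brouwerian_semilattice B by fact
  show ?thesis
    using assms sub_cbs_restrict[OF assms(3)]
    by (auto simp: cbs_embedding_def image_subset_iff)
qed

lemma cbs_embedding_inclusion:
  assumes "co_brouwerian_semilattice L" "sub_cbs S L"
  shows "cbs_embedding id (L\<lparr>carrier := S\<rparr>) L"
proof -
  interpret co_brouwerian_semilattice L by fact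
  show ?thesis
    using assms sub_cbs_restrict[OF assms(2)] by (auto simp: cbs_embedding_def sub_cbs_def)
qed

text \<open>The structure is copied along the bijection of the carrier with its image. This moves an
  extension into a prescribed type.\<close>

lemma cbs_transport:
  fixes h :: "'a \<Rightarrow> 'b"
  assumes "co_brouwerian_semilattice A" and h: "inj_on h (carrier A)"
  obtains B :: "'b gorder" where
    "co_brouwerian_semilattice B" "carrier B = h ` carrier A" "cbs_embedding h A B"
proof -
  interpret co_brouwerian_semilattice A by fact
  define k where "k = inv_into (carrier A) h"
  have kh [simp]: "k (h x) = x" if "x \<in> carrier A" for x using that h by (simp add: k_def)
  let ?le = "\<lambda>x y. k x \<sqsubseteq>\<^bsub>A\<^esub> k y"
  let ?j = "\<lambda>x y. h (k x \<squnion>\<^bsub>A\<^esub> k y)" and ?d = "\<lambda>x y. h (k x \<setminus>\<^bsub>A\<^esub> k y)"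
  interpret B: cbs_operations "h ` carrier A" ?le ?j ?d "h \<bottom>\<^bsub>A\<^esub>"
    by unfold_locales
      (auto simp: diff_le_iff join_left join_right join_le intro: le_trans
        arg_cong[of _ _ h, OF le_antisym])
  let ?B = "\<lparr>carrier = h ` carrier A, eq = (=), le = ?le\<rparr>"
  show thesis
  proof
    show "cbs_embedding h A ?B"
      using h by (auto simp: cbs_embedding_def B.bottom_eq B.join_eq B.diff_eq)
  qed (use B.cbs in auto)
qed

section \<open>Amalgamation\<close>

definition downset_algebra :: "'x set \<Rightarrow> ('x \<Rightarrow> 'x \<Rightarrow> bool) \<Rightarrow> 'x set gorder" where
  "downset_algebra X r =
    \<lparr>carrier = {D. D \<subseteq> X \<and> (\<forall>x\<in>D. \<forall>y\<in>X. r y x \<longrightarrow> y \<in> D)}, eq = (=), le = (\<subseteq>)\<rparr>"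

text \<open>The set difference of two downsets need not be a downset. Its down-closure is the least
  downset that together with \<open>E\<close> covers \<open>D\<close>, which is what a difference
  has to be.\<close>

lemma downset_algebra_cbs:
  assumes refl: "\<And>x. x \<in> X \<Longrightarrow> r x x"
    and trans: "\<And>x y z. \<lbrakk>x \<in> X; y \<in> X; z \<in> X; r x y; r y z\<rbrakk> \<Longrightarrow> r x z"
  defines "S \<equiv> downset_algebra X r"
  shows "co_brouwerian_semilattice S"
    and "\<bottom>\<^bsub>S\<^esub> = {}"
    and "\<lbrakk>D \<in> carrier S; E \<in> carrier S\<rbrakk> \<Longrightarrow> D \<squnion>\<^bsub>S\<^esub> E = D \<union> E"
    and "\<lbrakk>D \<in> carrier S; E \<in> carrier S\<rbrakk> \<Longrightarrow> D \<setminus>\<^bsub>S\<^esub> E = {y \<in> X. \<exists>x\<in>D - E. r y x}"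
proof -
  let ?A = "{D. D \<subseteq> X \<and> (\<forall>x\<in>D. \<forall>y\<in>X. r y x \<longrightarrow> y \<in> D)}"
  let ?d = "\<lambda>D E. {y \<in> X. \<exists>x\<in>D - E. r y x}"
  have d_closed: "?d D E \<in> ?A" if "D \<in> ?A" "E \<in> ?A" for D E
    using that trans by blast
  have d_iff: "?d D E \<subseteq> F \<longleftrightarrow> D \<subseteq> E \<union> F" if "D \<in> ?A" "E \<in> ?A" "F \<in> ?A" for D E F
    using that refl by blast
  interpret D: cbs_operations ?A "(\<subseteq>)" "(\<union>)" ?d "{}"
  proof unfold_locales
    show "?d D E \<in> ?A" if "D \<in> ?A" "E \<in> ?A" for D E using d_closed that .
    show "?d D E \<subseteq> F \<longleftrightarrow> D \<subseteq> E \<union> F" if "D \<in> ?A" "E \<in> ?A" "F \<in> ?A" for D E F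
      using d_iff that .
  qed auto
  have c: "carrier S = ?A" by (simp add: S_def downset_algebra_def)
  note * = D.cbs D.bottom_eq D.join_eq D.diff_eq
  note * = *[folded downset_algebra_def S_def]
  show "co_brouwerian_semilattice S" "\<bottom>\<^bsub>S\<^esub> = {}" by (fact *)+
  show "D \<squnion>\<^bsub>S\<^esub> E = D \<union> E" if "D \<in> carrier S" "E \<in> carrier S"
    using that unfolding c by (rule *)
  show "D \<setminus>\<^bsub>S\<^esub> E = ?d D E" if "D \<in> carrier S" "E \<in> carrier S"
    using that unfolding c by (rule *)
qed

lemma (in co_brouwerian_semilattice) cbs_ideal_join_iff:
  assumes I: "cbs_ideal I" and ab: "a \<in> carrier L" "b \<in> carrier L"
  shows "a \<squnion> b \<in> I \<longleftrightarrow> a \<in> I \<and> b \<in> I"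
proof
  assume "a \<squnion> b \<in> I"
  then show "a \<in> I \<and> b \<in> I"
    using cbs_idealD(4)[OF I ab(1)] cbs_idealD(4)[OF I ab(2)] join_left[OF ab] join_right[OF ab]
    by blast
qed (use cbs_idealD(3)[OF I] in blast)

text \<open>A representation by points labelled with ideals. Monotone labels make the images
  downsets; \<open>lift\<close>, the back condition of a p-morphism, supplies the points needed for
  differences; the point labelled by the zero ideal yields injectivity.\<close>

lemma (in co_brouwerian_semilattice) cbs_embedding_downset_algebra:
  assumes refl: "\<And>x. x \<in> X \<Longrightarrow> r x x"
    and trans: "\<And>x y z. \<lbrakk>x \<in> X; y \<in> X; z \<in> X; r x y; r y z\<rbrakk> \<Longrightarrow> r x z"
    and ideal: "\<And>x. x \<in> X \<Longrightarrow> cbs_ideal (\<pi> x)"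
    and mono: "\<And>x y. \<lbrakk>x \<in> X; y \<in> X; r x y\<rbrakk> \<Longrightarrow> \<pi> x \<subseteq> \<pi> y"
    and lift: "\<And>x I. \<lbrakk>x \<in> X; cbs_ideal I; \<pi> x \<subseteq> I\<rbrakk> \<Longrightarrow> \<exists>y\<in>X. r x y \<and> \<pi> y = I"
    and zero: "o0 \<in> X" "\<pi> o0 = {\<bottom>}"
  shows "cbs_embedding (\<lambda>a. {x \<in> X. a \<notin> \<pi> x}) L (downset_algebra X r)"
proof -
  let ?D = "downset_algebra X r" and ?f = "\<lambda>a. {x \<in> X. a \<notin> \<pi> x}"
  note D = downset_algebra_cbs[of X r, OF refl trans]
  have f: "?f a \<in> carrier ?D" for a
    using mono by (auto simp: downset_algebra_def)
  have separate: "\<exists>y\<in>X. r x y \<and> b \<in> \<pi> y \<and> a \<notin> \<pi> y"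
    if x: "x \<in> X" and ab: "a \<in> carrier L" "b \<in> carrier L" and "a \<setminus> b \<notin> \<pi> x" for x a b
  proof -
    \<comment> \<open>Adjoining \<open>b\<close> to the label of \<open>x\<close> does not bring in
      \<open>a\<close>, precisely because \<open>a \<setminus> b\<close> is outside that
      label.\<close>
    let ?I = "{w \<in> carrier L. le_mod (\<pi> x) w b}"
    note id = ideal[OF x]
    have "\<pi> x \<subseteq> ?I"
      using that le_mod_member[OF id] cbs_idealD(1)[OF id] by auto
    then obtain y where y: "y \<in> X" "r x y" "\<pi> y = ?I"
      using lift[OF x cbs_ideal_le_mod[OF id ab(2)]] by auto
    moreover have "b \<in> ?I" using that le_mod_le[OF id] by auto
    moreover have "a \<notin> ?I"
      using that le_mod_diff_iff[OF id, of a b \<bottom>] le_mod_bot_iff[OF id] by (simp add: join_bot)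
    ultimately show ?thesis by auto
  qed
  have le: "a \<sqsubseteq> b" if "a \<in> carrier L" "b \<in> carrier L" "?f a \<subseteq> ?f b" for a b
  proof (rule ccontr)
    assume "\<not> a \<sqsubseteq> b"
    then have "a \<setminus> b \<notin> \<pi> o0" using that zero by (simp add: diff_eq_bot_iff)
    then show False using separate[OF zero(1) that(1,2)] that(3) by blast
  qed
  have "?f (a \<squnion> b) = ?f a \<union> ?f b" if "a \<in> carrier L" "b \<in> carrier L" for a b
    using cbs_ideal_join_iff[OF ideal that] by blast
  moreover have "?f (a \<setminus> b) = {y \<in> X. \<exists>x\<in>?f a - ?f b. r y x}"
    if ab: "a \<in> carrier L" "b \<in> carrier L" for a b
  proof -
    have "a \<setminus> b \<notin> \<pi> y" if y: "y \<in> X" "x \<in> X" "r y x" "a \<notin> \<pi> x" "b \<in> \<pi> x" for x y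
    proof
      assume "a \<setminus> b \<in> \<pi> y"
      then have "a \<setminus> b \<in> \<pi> x" using mono y by blast
      then have "b \<squnion> (a \<setminus> b) \<in> \<pi> x" using cbs_idealD(3)[OF ideal] y by blast
      then have "a \<in> \<pi> x"
        using cbs_idealD(4)[OF ideal[OF \<open>x \<in> X\<close>] ab(1)] le_join_diff[OF ab] by blast
      then show False using y by blast
    qed
    then show ?thesis using separate[OF _ ab] by blast
  qed
  moreover have "?f \<bottom> = {}" using cbs_idealD(2)[OF ideal] by blast
  moreover have "inj_on ?f (carrier L)"
    using le by (intro inj_onI le_antisym) auto
  ultimately show ?thesis
    using f by (simp add: cbs_embedding_def D)
qed

text \<open>The back condition for pairs of ideals with the same trace on \<open>A\<close>: when the
  first component grows, the second can follow. The existing match prevents the new second component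
  from acquiring too large a trace.\<close>

lemma matching_ideal_lift:
  assumes "co_brouwerian_semilattice A" "co_brouwerian_semilattice L" "co_brouwerian_semilattice C"
    and f: "cbs_embedding f A L" and g: "cbs_embedding g A C"
    and I: "co_brouwerian_semilattice.cbs_ideal L I" and J: "co_brouwerian_semilattice.cbs_ideal C J"
    and match: "\<And>x. x \<in> carrier A \<Longrightarrow> f x \<in> I \<longleftrightarrow> g x \<in> J"
    and I': "co_brouwerian_semilattice.cbs_ideal L I'" and sub: "I \<subseteq> I'"
  obtains J' where "co_brouwerian_semilattice.cbs_ideal C J'" "J \<subseteq> J'"
    "\<And>x. x \<in> carrier A \<Longrightarrow> f x \<in> I' \<longleftrightarrow> g x \<in> J'"
proof -
  interpret A: co_brouwerian_semilattice A by fact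
  interpret L: co_brouwerian_semilattice L by fact
  interpret C: co_brouwerian_semilattice C by fact
  note fc = cbs_embeddingD(1)[OF f] and gc = cbs_embeddingD(1)[OF g]
  \<comment> \<open>The smallest candidate: the ideal generated by \<open>J\<close> and the elements
    \<open>g x\<close> with \<open>f x\<close> in \<open>I'\<close>.\<close>
  define J' where "J' = {c \<in> carrier C. \<exists>x\<in>carrier A. f x \<in> I' \<and> C.le_mod J c (g x)}"
  have bot: "f \<bottom>\<^bsub>A\<^esub> \<in> I'" using cbs_embeddingD(3)[OF f] L.cbs_idealD(2)[OF I'] by simp
  have sub': "J \<subseteq> J'"
    using C.cbs_idealD(1)[OF J] C.le_mod_member[OF J] gc bot by (auto simp: J'_def)
  have "c \<squnion>\<^bsub>C\<^esub> c' \<in> J'" if "c \<in> J'" "c' \<in> J'" for c c'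
  proof -
    obtain x y where xy: "x \<in> carrier A" "f x \<in> I'" "C.le_mod J c (g x)"
      "y \<in> carrier A" "f y \<in> I'" "C.le_mod J c' (g y)"
      using \<open>c \<in> J'\<close> \<open>c' \<in> J'\<close> unfolding J'_def by blast
    have c: "c \<in> carrier C" "c' \<in> carrier C" using that by (auto simp: J'_def)
    have "f (x \<squnion>\<^bsub>A\<^esub> y) \<in> I'" using xy cbs_embeddingD(4)[OF f] L.cbs_idealD(3)[OF I'] by simp
    moreover have "C.le_mod J (c \<squnion>\<^bsub>C\<^esub> c') (g (x \<squnion>\<^bsub>A\<^esub> y))"
      using xy c gc C.le_mod_join_mono[OF J] cbs_embeddingD(4)[OF g] by simp
    ultimately show ?thesis using xy c by (auto simp: J'_def)
  qed
  moreover have "c \<in> J'" if "c \<in> carrier C" "c' \<in> J'" "c \<sqsubseteq>\<^bsub>C\<^esub> c'" for c c'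
  proof -
    obtain x where x: "x \<in> carrier A" "f x \<in> I'" "C.le_mod J c' (g x)"
      using \<open>c' \<in> J'\<close> unfolding J'_def by blast
    have "c' \<in> carrier C" using that by (auto simp: J'_def)
    then have "C.le_mod J c (g x)"
      using that x gc C.le_mod_le[OF J] C.le_mod_trans[OF J, of c c' "g x"] by simp
    then show ?thesis using x that by (auto simp: J'_def)
  qed
  moreover have "\<bottom>\<^bsub>C\<^esub> \<in> J'" using sub' C.cbs_idealD(2)[OF J] by blast
  moreover have "J' \<subseteq> carrier C" by (auto simp: J'_def)
  ultimately have J': "C.cbs_ideal J'" unfolding C.cbs_ideal_def by blast
  have "f y \<in> I' \<longleftrightarrow> g y \<in> J'" if y: "y \<in> carrier A" for y
  proof
    assume "f y \<in> I'"
    then show "g y \<in> J'" using y gc C.le_mod_le[OF J] by (auto simp: J'_def)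
  next
    assume "g y \<in> J'"
    then obtain x where x: "x \<in> carrier A" "f x \<in> I'" "C.le_mod J (g y) (g x)"
      by (auto simp: J'_def)
    \<comment> \<open>The difference carries the relation modulo \<open>J\<close> back to
      \<open>A\<close>: \<open>g (y \<setminus> x)\<close> lies in \<open>J\<close>, so by the match
      \<open>f (y \<setminus> x)\<close> lies in \<open>I\<close>, hence in \<open>I'\<close>, and
      joining \<open>f x\<close> to it bounds \<open>f y\<close>.\<close>
    then have "C.le_mod J (g y \<setminus>\<^bsub>C\<^esub> g x) \<bottom>\<^bsub>C\<^esub>"
      using y gc by (simp add: C.le_mod_diff_iff[OF J] C.join_bot)
    then have "g (y \<setminus>\<^bsub>A\<^esub> x) \<in> J"
      using x y gc C.le_mod_bot_iff[OF J] by (simp add: cbs_embeddingD(5)[OF g])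
    then have "f y \<setminus>\<^bsub>L\<^esub> f x \<in> I'"
      using x y match[of "y \<setminus>\<^bsub>A\<^esub> x"] sub by (auto simp: cbs_embeddingD(5)[OF f])
    then have "f x \<squnion>\<^bsub>L\<^esub> (f y \<setminus>\<^bsub>L\<^esub> f x) \<in> I'" using x L.cbs_idealD(3)[OF I'] by blast
    then show "f y \<in> I'"
      using L.cbs_idealD(4)[OF I' fc[OF y]] L.le_join_diff[OF fc[OF y] fc[OF x(1)]] by blast
  qed
  with J' sub' show thesis using that by blast
qed

text \<open>The amalgam of \<open>L\<close> and \<open>C\<close> over \<open>A\<close> consists of downsets of the poset of pairs of ideals of
  \<open>L\<close> and \<open>C\<close> with the same trace on \<open>A\<close>; by the previous lemma both projections lift
  inclusions of ideals.\<close>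

theorem cbs_amalgamation:
  fixes L :: "('a, 'm) gorder_scheme" and C :: "('b, 'n) gorder_scheme"
  assumes A: "co_brouwerian_semilattice A"
    and L: "co_brouwerian_semilattice L" and C: "co_brouwerian_semilattice C"
    and f: "cbs_embedding f A L" and g: "cbs_embedding g A C"
  obtains D :: "('a set \<times> 'b set) set gorder" and p q where "co_brouwerian_semilattice D"
    "cbs_embedding p L D" "cbs_embedding q C D" "\<And>x. x \<in> carrier A \<Longrightarrow> p (f x) = q (g x)"
proof -
  interpret A: co_brouwerian_semilattice A by fact
  interpret L: co_brouwerian_semilattice L by fact
  interpret C: co_brouwerian_semilattice C by fact
  define X where "X = {(I, J). L.cbs_ideal I \<and> C.cbs_ideal J \<and> (\<forall>x\<in>carrier A. f x \<in> I \<longleftrightarrow> g x \<in> J)}"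
  define r :: "'a set \<times> 'b set \<Rightarrow> 'a set \<times> 'b set \<Rightarrow> bool"
    where "r P Q \<longleftrightarrow> fst P \<subseteq> fst Q \<and> snd P \<subseteq> snd Q" for P Q
  \<comment> \<open>Both embeddings are injective, so the two zero ideals have the same trace,
    namely the zero of \<open>A\<close>.\<close>
  have zero: "({\<bottom>\<^bsub>L\<^esub>}, {\<bottom>\<^bsub>C\<^esub>}) \<in> X"
  proof -
    have "f x = \<bottom>\<^bsub>L\<^esub> \<longleftrightarrow> x = \<bottom>\<^bsub>A\<^esub>" "g x = \<bottom>\<^bsub>C\<^esub> \<longleftrightarrow> x = \<bottom>\<^bsub>A\<^esub>" if "x \<in> carrier A" for x
      using that cbs_embeddingD(2,3)[OF f] cbs_embeddingD(2,3)[OF g]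
      by (metis A.bottom_closed inj_onD)+
    then show ?thesis using L.cbs_ideal_bot C.cbs_ideal_bot by (auto simp: X_def)
  qed
  have refl: "r x x" for x by (simp add: r_def)
  have trans: "r x z" if "r x y" "r y z" for x y z using that by (auto simp: r_def)
  have "co_brouwerian_semilattice (downset_algebra X r)"
    using refl trans by (rule downset_algebra_cbs)
  moreover have "cbs_embedding (\<lambda>a. {x \<in> X. a \<notin> fst x}) L (downset_algebra X r)"
  proof (rule L.cbs_embedding_downset_algebra[OF refl trans _ _ _ zero])
    show "L.cbs_ideal (fst x)" if "x \<in> X" for x using that by (auto simp: X_def)
    show "fst x \<subseteq> fst y" if "r x y" for x y using that by (simp add: r_def)
    show "\<exists>y\<in>X. r x y \<and> fst y = I'" if x: "x \<in> X" "L.cbs_ideal I'" "fst x \<subseteq> I'" for x I'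
    proof -
      obtain I J where IJ: "x = (I, J)" by (cases x)
      then have *: "L.cbs_ideal I" "C.cbs_ideal J" "\<And>x. x \<in> carrier A \<Longrightarrow> f x \<in> I \<longleftrightarrow> g x \<in> J" "I \<subseteq> I'"
        using x by (auto simp: X_def)
      obtain J' where "C.cbs_ideal J'" "J \<subseteq> J'" "\<And>x. x \<in> carrier A \<Longrightarrow> f x \<in> I' \<longleftrightarrow> g x \<in> J'"
        by (rule matching_ideal_lift[OF A L C f g *(1,2) *(3) x(2) *(4)]) auto
      then show ?thesis using IJ x by (intro bexI[of _ "(I', J')"]) (auto simp: X_def r_def)
    qed
  qed simp_all
  moreover have "cbs_embedding (\<lambda>a. {x \<in> X. a \<notin> snd x}) C (downset_algebra X r)"
  proof (rule C.cbs_embedding_downset_algebra[OF refl trans _ _ _ zero])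
    show "C.cbs_ideal (snd x)" if "x \<in> X" for x using that by (auto simp: X_def)
    show "snd x \<subseteq> snd y" if "r x y" for x y using that by (simp add: r_def)
    show "\<exists>y\<in>X. r x y \<and> snd y = J'" if x: "x \<in> X" "C.cbs_ideal J'" "snd x \<subseteq> J'" for x J'
    proof -
      obtain I J where IJ: "x = (I, J)" by (cases x)
      then have *: "L.cbs_ideal I" "C.cbs_ideal J" "\<And>x. x \<in> carrier A \<Longrightarrow> g x \<in> J \<longleftrightarrow> f x \<in> I" "J \<subseteq> J'"
        using x by (auto simp: X_def)
      obtain I' where "L.cbs_ideal I'" "I \<subseteq> I'" "\<And>x. x \<in> carrier A \<Longrightarrow> g x \<in> J' \<longleftrightarrow> f x \<in> I'"
        by (rule matching_ideal_lift[OF A C L g f *(2,1) *(3) x(2) *(4)]) auto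
      then show ?thesis using IJ x by (intro bexI[of _ "(I', J')"]) (auto simp: X_def r_def)
    qed
  qed simp_all
  \<comment> \<open>The trace condition built into \<open>X\<close> is exactly what makes the square
    commute.\<close>
  moreover have "{y \<in> X. f x \<notin> fst y} = {y \<in> X. g x \<notin> snd y}" if "x \<in> carrier A" for x
    using that by (auto simp: X_def)
  ultimately show thesis by (rule that)
qed

section \<open>Cardinality of generated sub-CBSes\<close>

lemma Un_lepoll_infinite:
  assumes "infinite K" "Y \<lesssim> K" "Z \<lesssim> K"
  shows "Y \<union> Z \<lesssim> K"
proof -
  include cardinal_syntax
  have iff: "U \<lesssim> K \<longleftrightarrow> |U| \<le>o |K|" for U :: "'z set"
    by (simp add: lepoll_def card_of_ordLeq)
  show ?thesis
    using assms unfolding iff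
    by (intro card_of_Un_ordLeq_infinite_Field) (simp_all add: card_of_card_order_on Field_card_of)
qed

text \<open>Generation takes countably many stages, each adding the values of the operations at
  pairs from the stage before. An infinite \<open>K\<close> absorbs pairs and countable
  unions.\<close>

lemma generated_lepoll:
  fixes L :: "('a, 'm) gorder_scheme" and K :: "'k set"
  assumes K: "infinite K" and X: "X \<lesssim> K"
  shows "generated L X \<lesssim> K"
proof -
  include cardinal_syntax
  define S where "S = rec_nat (insert \<bottom>\<^bsub>L\<^esub> X)
    (\<lambda>_ T. T \<union> (\<lambda>(a, b). a \<squnion>\<^bsub>L\<^esub> b) ` (T \<times> T) \<union> (\<lambda>(a, b). a \<setminus>\<^bsub>L\<^esub> b) ` (T \<times> T))"
  have S: "S 0 = insert \<bottom>\<^bsub>L\<^esub> X"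
    "S (Suc n) = S n \<union> (\<lambda>(a, b). a \<squnion>\<^bsub>L\<^esub> b) ` (S n \<times> S n) \<union> (\<lambda>(a, b). a \<setminus>\<^bsub>L\<^esub> b) ` (S n \<times> S n)" for n
    by (simp_all add: S_def)
  have mono: "S m \<subseteq> S n" if "m \<le> n" for m n
    by (rule lift_Suc_mono_le[of S, OF _ that]) (auto simp: S)
  have "x \<in> (\<Union>n. S n)" if "x \<in> generated L X" for x
    using that
  proof induction
    case (join a b)
    then obtain m n where "a \<in> S m" "b \<in> S n" by blast
    then have "a \<in> S (max m n)" "b \<in> S (max m n)" using mono[of m "max m n"] mono[of n "max m n"] by auto
    then have "a \<squnion>\<^bsub>L\<^esub> b \<in> S (Suc (max m n))" by (auto simp: S)
    then show ?case by blast
  next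
    case (diff a b)
    then obtain m n where "a \<in> S m" "b \<in> S n" by blast
    then have "a \<in> S (max m n)" "b \<in> S (max m n)" using mono[of m "max m n"] mono[of n "max m n"] by auto
    then have "a \<setminus>\<^bsub>L\<^esub> b \<in> S (Suc (max m n))" by (auto simp: S)
    then show ?case by blast
  next
    case (base x)
    then have "x \<in> S 0" by (simp add: S)
    then show ?case by blast
  next
    case zero
    have "\<bottom>\<^bsub>L\<^esub> \<in> S 0" by (simp add: S)
    then show ?case by blast
  qed
  then have "generated L X \<subseteq> (\<Union>n. S n)" by blast
  moreover have "(\<Union>n. S n) \<lesssim> K"
  proof -
    have iff: "Y \<lesssim> K \<longleftrightarrow> |Y| \<le>o |K|" for Y :: "'z set"
      by (simp add: lepoll_def card_of_ordLeq)
    note Un = Un_lepoll_infinite[OF K, unfolded iff]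
    have image: "|F ` (Y \<times> Y)| \<le>o |K|" if "|Y| \<le>o |K|" for F :: "'a \<times> 'a \<Rightarrow> 'a" and Y :: "'a set"
      using that K
      by (intro ordLeq_transitive[OF card_of_image card_of_Times_ordLeq_infinite_Field])
        (simp_all add: card_of_card_order_on Field_card_of)
    have "|{\<bottom>\<^bsub>L\<^esub>}| \<le>o |K|"
      unfolding iff[symmetric] using K by (simp add: finite_lepoll_infinite)
    then have "|{\<bottom>\<^bsub>L\<^esub>} \<union> X| \<le>o |K|" using X Un unfolding iff by blast
    then have "|S n| \<le>o |K|" for n
      by (induction n) (simp_all add: S Un image)
    moreover have "|UNIV :: nat set| \<le>o |K|" using K by (simp add: infinite_iff_card_of_nat)
    ultimately show ?thesis unfolding iff using K by (intro card_of_UNION_ordLeq_infinite) auto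
  qed
  ultimately show ?thesis by (meson lepoll_trans1 subset_imp_lepoll lepoll_trans)
qed

section \<open>Diagrams and existential closedness\<close>

lemma term_val_embedding:
  assumes "co_brouwerian_semilattice A" and f: "cbs_embedding f A B"
    and "\<And>p. p \<in> term_params t \<Longrightarrow> e p \<in> carrier A \<and> e' p = f (e p)"
    and "\<And>n. n \<in> term_vars t \<Longrightarrow> v n \<in> carrier A \<and> v' n = f (v n)"
  shows "term_val A e v t \<in> carrier A \<and> term_val B e' v' t = f (term_val A e v t)"
proof -
  interpret A: co_brouwerian_semilattice A by fact
  show ?thesis using assms(3,4) by (induction t) (auto simp: cbs_embeddingD[OF f])
qed

text \<open>Injectivity makes equations equivalent in both structures, so negation passes through as
  well. The assignments are compared only at symbols that occur, since they may be arbitrary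
  elsewhere.\<close>

lemma qf_sat_embedding:
  assumes A: "co_brouwerian_semilattice A" and f: "cbs_embedding f A B"
    and "\<And>p. p \<in> qf_params \<phi> \<Longrightarrow> e p \<in> carrier A \<and> e' p = f (e p)"
    and "\<And>n. n \<in> qf_vars \<phi> \<Longrightarrow> v n \<in> carrier A \<and> v' n = f (v n)"
  shows "qf_sat B e' v' \<phi> \<longleftrightarrow> qf_sat A e v \<phi>"
  using assms(3,4)
proof (induction \<phi>)
  case (Eq s t)
  then show ?case
    using term_val_embedding[OF A f, of s e e' v v'] term_val_embedding[OF A f, of t e e' v v']
      cbs_embeddingD(2)[OF f] by (auto dest: inj_onD)
qed auto

text \<open>The map \<open>f\<close> names the elements of \<open>C\<close> by variables. The
  inequations force a solution to be injective, and the equations with parameters force it to send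
  \<open>i p\<close> to \<open>p\<close>.\<close>

definition diagram ::
  "('b, 'm) gorder_scheme \<Rightarrow> ('b \<Rightarrow> nat) \<Rightarrow> ('p \<Rightarrow> 'b) \<Rightarrow> 'p set \<Rightarrow> 'p qf_formula set" where
  "diagram C f i P =
    {Eq (Var (f \<bottom>\<^bsub>C\<^esub>)) Zero} \<union>
    (\<lambda>(a, b). Eq (Var (f (a \<squnion>\<^bsub>C\<^esub> b))) (Join (Var (f a)) (Var (f b)))) ` (carrier C \<times> carrier C) \<union>
    (\<lambda>(a, b). Eq (Var (f (a \<setminus>\<^bsub>C\<^esub> b))) (Diff (Var (f a)) (Var (f b)))) ` (carrier C \<times> carrier C) \<union>
    (\<lambda>(a, b). Neg (Eq (Var (f a)) (Var (f b)))) ` {(a, b) \<in> carrier C \<times> carrier C. a \<noteq> b} \<union>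
    (\<lambda>p. Eq (Var (f (i p))) (Param p)) ` P"

lemma finite_diagram: "\<lbrakk>finite (carrier C); finite P\<rbrakk> \<Longrightarrow> finite (diagram C f i P)"
  unfolding diagram_def by (auto intro: finite_subset[of _ "carrier C \<times> carrier C"])

lemma diagram_params: "\<phi> \<in> diagram C f i P \<Longrightarrow> qf_params \<phi> \<subseteq> P"
  by (auto simp: diagram_def)

lemma diagram_vars:
  assumes "co_brouwerian_semilattice C" "i ` P \<subseteq> carrier C" "\<phi> \<in> diagram C f i P"
  shows "qf_vars \<phi> \<subseteq> f ` carrier C"
proof -
  interpret C: co_brouwerian_semilattice C by fact
  show ?thesis using assms(2,3) by (auto simp: diagram_def)
qed

lemma diagram_sat_iff:
  assumes "(\<lambda>c. v (f c)) \<in> carrier C \<rightarrow> carrier A"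
  shows "(\<forall>\<phi>\<in>diagram C f i P. qf_sat A e v \<phi>) \<longleftrightarrow>
    cbs_embedding (\<lambda>c. v (f c)) C A \<and> (\<forall>p\<in>P. v (f (i p)) = e p)"
  using assms by (auto simp: diagram_def cbs_embedding_def inj_on_def ball_Un)

primrec conj_list :: "'p qf_formula list \<Rightarrow> 'p qf_formula" where
  "conj_list [] = Eq Zero Zero"
| "conj_list (\<phi> # \<phi>s) = Conj \<phi> (conj_list \<phi>s)"

lemma qf_sat_conj_list: "qf_sat A e v (conj_list \<phi>s) \<longleftrightarrow> (\<forall>\<phi>\<in>set \<phi>s. qf_sat A e v \<phi>)"
  by (induction \<phi>s) auto

lemma qf_params_conj_list: "qf_params (conj_list \<phi>s) = (\<Union>\<phi>\<in>set \<phi>s. qf_params \<phi>)"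
  by (induction \<phi>s) auto

lemma qf_vars_conj_list: "qf_vars (conj_list \<phi>s) = (\<Union>\<phi>\<in>set \<phi>s. qf_vars \<phi>)"
  by (induction \<phi>s) auto

section \<open>From existential closedness to embeddings of finite extensions\<close>

lemma existentially_closed_extends_finite:
  fixes L :: "'a gorder" and C :: "'c gorder"
  assumes L: "co_brouwerian_semilattice L"
    and inf: "infinite (UNIV :: 'b set)" and card: "carrier L \<lesssim> (UNIV :: 'b set)"
    and ec: "existentially_closed TYPE('b) L"
    and L0: "sub_cbs L0 L" "finite L0"
    and C: "co_brouwerian_semilattice C" "finite (carrier C)"
    and i: "cbs_embedding i (L\<lparr>carrier := L0\<rparr>) C"
  shows "\<exists>g. cbs_embedding g C L \<and> (\<forall>x\<in>L0. g (i x) = x)"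
proof -
  interpret L: co_brouwerian_semilattice L by fact
  obtain D :: "('a set \<times> 'c set) set gorder" and p q where D: "co_brouwerian_semilattice D"
    and p: "cbs_embedding p L D" and q: "cbs_embedding q C D"
    and "\<And>x. x \<in> carrier (L\<lparr>carrier := L0\<rparr>) \<Longrightarrow> p (id x) = q (i x)"
    by (rule cbs_amalgamation[OF L.sub_cbs_restrict(1)[OF L0(1)] L C(1)
        cbs_embedding_inclusion[OF L L0(1)] i]) (erule (2) that, simp)
  then have pq: "p x = q (i x)" if "x \<in> L0" for x using that by simp
  interpret D: co_brouwerian_semilattice D by fact
  \<comment> \<open>The amalgam lives in a type of sets of pairs of sets. The part generated by the
    two images has at most the cardinality of \<open>'b\<close>, as \<open>C\<close> is finite, and
    so can be copied there.\<close>
  let ?X = "p ` carrier L \<union> q ` carrier C"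
  let ?S = "D\<lparr>carrier := generated D ?X\<rparr>"
  have X: "?X \<subseteq> carrier D" using cbs_embeddingD(1)[OF p] cbs_embeddingD(1)[OF q] by auto
  note S = D.sub_cbs_generated[OF X]
  have "p ` carrier L \<lesssim> (UNIV :: 'b set)" using card image_lepoll lepoll_trans by blast
  then have "?X \<lesssim> (UNIV :: 'b set)"
    using inf C(2) by (simp add: Un_lepoll_infinite finite_lepoll_infinite)
  from generated_lepoll[OF inf this, of D]
  obtain h :: "('a set \<times> 'c set) set \<Rightarrow> 'b" where h: "inj_on h (generated D ?X)"
    unfolding lepoll_def by (elim exE conjE)
  obtain B :: "'b gorder" where B: "co_brouwerian_semilattice B" "cbs_embedding h ?S B"
    by (rule cbs_transport[OF D.sub_cbs_restrict(1)[OF S], of h]) (use h in simp_all)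
  have p': "cbs_embedding (h \<circ> p) L B"
    using cbs_embedding_comp[OF cbs_embedding_into_sub_cbs[OF D p S] B(2)] by (auto intro: generated.base)
  have q': "cbs_embedding (h \<circ> q) C B"
    using cbs_embedding_comp[OF cbs_embedding_into_sub_cbs[OF D q S] B(2)] by (auto intro: generated.base)
  obtain n and f :: "'c \<Rightarrow> nat" where f: "f ` carrier C = {..<n}" "inj_on f (carrier C)"
    using finite_imp_inj_to_nat_seg[OF C(2)] by (auto simp: lessThan_def)
  obtain \<phi>s where \<phi>s: "set \<phi>s = diagram C f i L0"
    using finite_list[OF finite_diagram[OF C(2) L0(2)]] by blast
  have iL0: "i ` L0 \<subseteq> carrier C" using cbs_embeddingD(1)[OF i] by auto
  define \<phi> where "\<phi> = Exists n (conj_list \<phi>s)"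
  \<comment> \<open>The elements of \<open>C\<close> inside \<open>B\<close>, listed by their
    numbers; beyond \<open>n\<close> the values are arbitrary, and no variable of the sentence
    occurs there.\<close>
  define v where "v k = h (q (inv_into (carrier C) f k))" for k
  have vf: "v (f c) = (h \<circ> q) c" if "c \<in> carrier C" for c
    using that f by (simp add: v_def)
  have emb: "cbs_embedding (\<lambda>c. v (f c)) C B"
    using cbs_embedding_cong[OF C(1) q' vf] .
  have "qf_vars (conj_list \<phi>s) \<subseteq> {..<n}"
    unfolding qf_vars_conj_list \<phi>s f(1)[symmetric]
    by (intro UN_least diagram_vars[OF C(1) iL0])
  moreover have "qf_params (conj_list \<phi>s) \<subseteq> L0"
    unfolding qf_params_conj_list \<phi>s by (intro UN_least diagram_params)
  ultimately have "existential_sentence (carrier L) \<phi>"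
    using L0(1) by (auto simp: \<phi>_def sub_cbs_def)
  moreover have "true_in B (h \<circ> p) \<phi>"
  proof -
    have "v k \<in> carrier B" if "k < n" for k
    proof -
      have "k \<in> f ` carrier C" using f(1) that by simp
      then show ?thesis using cbs_embeddingD(1)[OF emb] by auto
    qed
    moreover have "\<forall>\<psi>\<in>diagram C f i L0. qf_sat B (h \<circ> p) v \<psi>"
    proof (subst diagram_sat_iff)
      show "(\<lambda>c. v (f c)) \<in> carrier C \<rightarrow> carrier B" using cbs_embeddingD(1)[OF emb] by simp
      have "v (f (i x)) = (h \<circ> p) x" if "x \<in> L0" for x
        using vf[of "i x"] pq[OF that] iL0 that by auto
      then show "cbs_embedding (\<lambda>c. v (f c)) C B \<and> (\<forall>x\<in>L0. v (f (i x)) = (h \<circ> p) x)"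
        using emb by blast
    qed
    ultimately show ?thesis unfolding \<phi>_def true_in.simps qf_sat_conj_list \<phi>s by blast
  qed
  ultimately have "true_in L (\<lambda>p. p) \<phi>"
    using ec B(1) p' unfolding existentially_closed_def by blast
  then obtain w where w: "\<forall>k<n. w k \<in> carrier L" "\<forall>\<psi>\<in>diagram C f i L0. qf_sat L (\<lambda>p. p) w \<psi>"
    unfolding \<phi>_def true_in.simps qf_sat_conj_list \<phi>s by blast
  \<comment> \<open>The witnesses \<open>w\<close>, read through the numbering \<open>f\<close>,
    form the required embedding.\<close>
  have "(\<lambda>c. w (f c)) \<in> carrier C \<rightarrow> carrier L" using w(1) f(1) by auto
  from diagram_sat_iff[OF this, of i L0 "\<lambda>p. p"] w(2) show ?thesis
    by (intro exI[of _ "\<lambda>c. w (f c)"]) simp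
qed

section \<open>From embeddings of finite extensions to existential closedness\<close>

lemma finite_qf_params: "finite (qf_params \<phi>)"
proof -
  have "finite (term_params t)" for t :: "'p cbs_term" by (induction t) auto
  then show ?thesis by (induction \<phi>) auto
qed

lemma extends_finite_existentially_closed:
  fixes L :: "'a gorder"
  assumes L: "co_brouwerian_semilattice L" and inf: "infinite (UNIV :: 'c set)"
    and ext: "\<And>L0 (C :: 'c gorder) i. \<lbrakk>sub_cbs L0 L; finite L0; co_brouwerian_semilattice C;
      finite (carrier C); cbs_embedding i (L\<lparr>carrier := L0\<rparr>) C\<rbrakk> \<Longrightarrow>
      \<exists>g. cbs_embedding g C L \<and> (\<forall>x\<in>L0. g (i x) = x)"
  shows "existentially_closed TYPE('b) L"
  unfolding existentially_closed_def
proof (intro allI impI)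
  fix B :: "'b gorder" and e \<phi>
  assume B: "co_brouwerian_semilattice B" and e: "cbs_embedding e L B"
    and \<phi>: "existential_sentence (carrier L) \<phi>" "true_in B e \<phi>"
  interpret L: co_brouwerian_semilattice L by fact
  interpret B: co_brouwerian_semilattice B by fact
  obtain n \<psi> where \<psi>: "\<phi> = Exists n \<psi>" by (cases \<phi>)
  then have vars: "qf_vars \<psi> \<subseteq> {..<n}" and params: "qf_params \<psi> \<subseteq> carrier L" using \<phi> by auto
  obtain v where v: "\<forall>k<n. v k \<in> carrier B" "qf_sat B e v \<psi>" using \<phi> \<psi> by auto
  define L0 where "L0 = generated L (qf_params \<psi>)"
  have L0: "sub_cbs L0 L" "finite L0"
    using L.sub_cbs_generated[OF params] L.finite_generated[OF finite_qf_params params]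
    by (auto simp: L0_def)
  then have L0c: "L0 \<subseteq> carrier L" by (simp add: sub_cbs_def)
  let ?X = "e ` L0 \<union> v ` {..<n}"
  define S where "S = B\<lparr>carrier := generated B ?X\<rparr>"
  have X: "?X \<subseteq> carrier B" "finite ?X" using v L0c L0 cbs_embeddingD(1)[OF e] by auto
  have subS: "sub_cbs (generated B ?X) B" using B.sub_cbs_generated X by blast
  have S: "co_brouwerian_semilattice S" using B.sub_cbs_restrict(1)[OF subS] by (simp add: S_def)
  have finS: "finite (carrier S)" using B.finite_generated X by (simp add: S_def)
  \<comment> \<open>The finite CBS \<open>S\<close> is copied into \<open>'c\<close>, where the
    hypothesis on finite extensions speaks.\<close>
  obtain h :: "'b \<Rightarrow> 'c" where h: "inj_on h (carrier S)"
    using finite_lepoll_infinite[OF inf finS] unfolding lepoll_def by blast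
  obtain C :: "'c gorder" where C: "co_brouwerian_semilattice C" "carrier C = h ` carrier S"
    and hC: "cbs_embedding h S C"
    using cbs_transport[OF S h] by blast
  have "cbs_embedding (e \<circ> id) (L\<lparr>carrier := L0\<rparr>) B"
    using cbs_embedding_comp[OF cbs_embedding_inclusion[OF L L0(1)] e] .
  then have "cbs_embedding e (L\<lparr>carrier := L0\<rparr>) S"
    unfolding S_def using subS B by (intro cbs_embedding_into_sub_cbs) (auto intro: generated.base)
  then have "cbs_embedding (h \<circ> e) (L\<lparr>carrier := L0\<rparr>) C" using hC by (rule cbs_embedding_comp)
  then obtain g where g: "cbs_embedding g C L" "\<forall>x\<in>L0. g ((h \<circ> e) x) = x"
    using ext[OF L0 C(1), of "h \<circ> e"] C(2) finS by auto
  have inS: "e p \<in> carrier S" if "p \<in> qf_params \<psi>" for p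
    using that by (auto simp: S_def L0_def intro!: generated.base)
  have vS: "v k \<in> carrier S" if "k \<in> qf_vars \<psi>" for k
    using that vars by (auto simp: S_def intro!: generated.base)
  have "qf_sat B e v \<psi> \<longleftrightarrow> qf_sat S e v \<psi>"
    using cbs_embedding_inclusion[OF B subS] inS vS
    by (intro qf_sat_embedding[OF S, of id]) (auto simp: S_def)
  \<comment> \<open>The witnesses travel from \<open>S\<close> through \<open>C\<close> to
    \<open>L\<close>. The parameters return to themselves, because they lie in \<open>L0\<close> and
    \<open>g\<close> undoes \<open>h \<circ> e\<close> there.\<close>
  moreover have "qf_sat L (\<lambda>p. p) ((g \<circ> h) \<circ> v) \<psi> \<longleftrightarrow> qf_sat S e v \<psi>"
  proof (rule qf_sat_embedding[OF S cbs_embedding_comp[OF hC g(1)]])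
    show "e p \<in> carrier S \<and> p = (g \<circ> h) (e p)" if "p \<in> qf_params \<psi>" for p
      using that inS g(2) generated.base[of p "qf_params \<psi>" L] by (auto simp: L0_def)
  qed (use vS in auto)
  moreover have "(g \<circ> h \<circ> v) k \<in> carrier L" if "k < n" for k
  proof -
    have "v k \<in> carrier S" using that by (auto simp: S_def intro!: generated.base)
    then show ?thesis using cbs_embeddingD(1)[OF hC] cbs_embeddingD(1)[OF g(1)] by simp
  qed
  ultimately show "true_in L (\<lambda>p. p) \<phi>"
    using v(2) by (auto simp: \<psi> simp del: comp_apply intro!: exI[of _ "g \<circ> h \<circ> v"])
qed

text \<open>The types provide the room that quantification over all structures would need:
  \<open>'b\<close> is infinite and at least as large as \<open>L\<close>, and the infinite
  \<open>'c\<close> contains a copy of every finite CBS. An extension of \<open>L0\<close> is given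
  by an embedding \<open>i\<close>, so fixing \<open>L0\<close> pointwise becomes
  \<open>g (i x) = x\<close>.\<close>

theorem theorem2p16:
  fixes L :: "'a gorder"
  assumes "co_brouwerian_semilattice L"
    and "infinite (UNIV :: 'b set)" and "carrier L \<lesssim> (UNIV :: 'b set)"
    and "infinite (UNIV :: 'c set)"
  shows "existentially_closed TYPE('b) L \<longleftrightarrow>
    (\<forall>L0 (C :: 'c gorder) i.
      sub_cbs L0 L \<longrightarrow> finite L0 \<longrightarrow>
      co_brouwerian_semilattice C \<longrightarrow> finite (carrier C) \<longrightarrow>
      cbs_embedding i (L\<lparr>carrier := L0\<rparr>) C \<longrightarrow>
      (\<exists>g. cbs_embedding g C L \<and> (\<forall>x\<in>L0. g (i x) = x)))"
  using existentially_closed_extends_finite[OF assms(1-3)]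
    extends_finite_existentially_closed[OF assms(1,4)] by blast

end
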